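(* Let $(X_t)_{t\ge0}$ be an ergodic Markov chain on a countable state space $\mathcal X$ with transition matrix $P=(P_{i,j})_{i,j\in\mathcal X}$, $n$-step transition probabilities $P^{(n)}_{i,j}$ and stationary distribution $\pi=(\pi_i)_{i\in\mathcal X}$, and fix $i\in\mathcal X$. Let $T_{\pi,i}$ have the law of $\inf\{t\ge0:X_t=i\}$ when $\mathcal L(X_0)=\pi$, and let $T_{j,i}$ have the law of $\inf\{t>0:X_t=i\}$ when $X_0=j$. Let $T_{i,\pi}$ be a stationary time starting from state $i$, i.e. a stopping time with $\mathcal L(X_{T_{i,\pi}}\mid X_0=i)=\pi$, and let $\rho=\mathbb{P}[T_{i,i}<T_{i,\pi}]$, where $T_{i,i}$ and $T_{i,\pi}$ are based on the same copy of the Markov chain started at $i$. Then $$d_{\mathrm K}(\mathcal L(\pi_iT_{\pi,i}),\mathrm{Exp}(1))\le 2\pi_i+\min\Bigl\{\pi_i\Bigl(\mathbb{E}T_{i,\pi}+\rho\,\sup_{j\in\mathcal X}\mathbb{E}T_{j,i}\Bigr),\ \sum_{n=1}^\infty\bigl|P^{(n)}_{i,i}-\pi_i\bigr|\Bigr\}.$$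
   Context: $\mathcal{L}(X)$ denotes the law of $X$; $\mathrm{Exp}(1)$ is the exponential distribution with mean $1$; $d_{\mathrm K}(P,Q)=\sup_{z\in\mathbb{R}}|P((-\infty,z])-Q((-\infty,z])|$ is the Kolmogorov distance. The Markov chain is in discrete time and time-homogeneous; ergodic means in particular irreducible and positive recurrent, so $\pi$ is unique and $\pi_i>0$. Convention: $0\cdot\infty=0$. *)

theory Defs
  imports "HOL-Probability.Probability"
begin

definition kolmogorov_dist :: "real measure \<Rightarrow> real measure \<Rightarrow> real" where
  "kolmogorov_dist P Q = (SUP z. \<bar>measure P {..z} - measure Q {..z}\<bar>)"

text \<open>A transition matrix \<open>P\<close> on a countable state space is given by its rows,
  \<open>P\<^bsub>x,y\<^esub> = pmf (K x) y\<close>.\<close>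

primrec nstep :: "('s \<Rightarrow> 's pmf) \<Rightarrow> nat \<Rightarrow> 's \<Rightarrow> 's pmf" where
  "nstep K 0 x = return_pmf x"
| "nstep K (Suc n) x = bind_pmf (K x) (nstep K n)"

definition stationary :: "('s \<Rightarrow> 's pmf) \<Rightarrow> 's pmf \<Rightarrow> bool" where
  "stationary K \<pi> \<longleftrightarrow> bind_pmf \<pi> K = \<pi>"

text \<open>The law of the chain on path space, by the Ionescu-Tulcea theorem: the conditional law of
  coordinate \<open>n\<close> given the coordinates before \<open>n\<close>.\<close>

definition chain_kernel ::
    "('s \<Rightarrow> 's pmf) \<Rightarrow> 's pmf \<Rightarrow> nat \<Rightarrow> (nat \<Rightarrow> 's) \<Rightarrow> 's measure" where
  "chain_kernel K \<mu> n \<omega> = (case n of 0 \<Rightarrow> measure_pmf \<mu> | Suc m \<Rightarrow> measure_pmf (K (\<omega> m)))"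

lemma Ionescu_Tulcea_chain_kernel:
  fixes K :: "'s::countable \<Rightarrow> 's pmf"
  shows "Ionescu_Tulcea (chain_kernel K \<mu>) (\<lambda>_. count_space UNIV)"
proof (rule Ionescu_Tulcea.intro)
  fix n :: nat
  show "chain_kernel K \<mu> n \<in> PiM {0..<n} (\<lambda>_. count_space UNIV) \<rightarrow>\<^sub>M subprob_algebra (count_space UNIV)"
  proof (cases n)
    case 0
    then show ?thesis
      by (auto simp: chain_kernel_def[abs_def] space_subprob_algebra intro!: measurable_const
          measure_pmf.subprob_space_axioms)
  next
    case (Suc m)
    have "(\<lambda>\<omega>. \<omega> m) \<in> PiM {0..<n} (\<lambda>_. count_space UNIV) \<rightarrow>\<^sub>M (count_space UNIV :: 's measure)"
      using Suc by (intro measurable_component_singleton) auto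
    moreover have "(\<lambda>x. measure_pmf (K x)) \<in> count_space UNIV \<rightarrow>\<^sub>M subprob_algebra (count_space UNIV)"
      by (auto simp: space_subprob_algebra intro: measure_pmf.subprob_space_axioms)
    ultimately show ?thesis
      using Suc by (auto simp: chain_kernel_def[abs_def] intro: measurable_compose)
  qed
  show "prob_space (chain_kernel K \<mu> n x)" for x
    by (auto simp: chain_kernel_def measure_pmf.prob_space_axioms split: nat.split)
qed

global_interpretation path: Ionescu_Tulcea "chain_kernel K \<mu>" "\<lambda>_. count_space UNIV"
  for K :: "'s::countable \<Rightarrow> 's pmf" and \<mu> :: "'s pmf"
  by (rule Ionescu_Tulcea_chain_kernel)

definition path_law :: "('s::countable \<Rightarrow> 's pmf) \<Rightarrow> 's pmf \<Rightarrow> (nat \<Rightarrow> 's) measure" where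
  "path_law K \<mu> = path.PF.lim K \<mu>"

definition hit_time :: "'s \<Rightarrow> (nat \<Rightarrow> 's) \<Rightarrow> enat" where
  "hit_time i \<omega> = Inf (enat ` {t. \<omega> t = i})"

definition return_time :: "'s \<Rightarrow> (nat \<Rightarrow> 's) \<Rightarrow> enat" where
  "return_time i \<omega> = Inf (enat ` {t. 0 < t \<and> \<omega> t = i})"

definition mean_return_time :: "('s::countable \<Rightarrow> 's pmf) \<Rightarrow> 's \<Rightarrow> 's \<Rightarrow> ennreal" where
  "mean_return_time K j i = (\<integral>\<^sup>+ \<omega>. ennreal_of_enat (return_time i \<omega>) \<partial>path_law K (return_pmf j))"

definition irreducible_chain :: "('s \<Rightarrow> 's pmf) \<Rightarrow> bool" where
  "irreducible_chain K \<longleftrightarrow> (\<forall>x y. \<exists>n. 0 < pmf (nstep K n x) y)"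

definition positive_recurrent :: "('s::countable \<Rightarrow> 's pmf) \<Rightarrow> bool" where
  "positive_recurrent K \<longleftrightarrow> (\<forall>x. mean_return_time K x x < \<infinity>)"

text \<open>Aperiodicity is not required here.\<close>

definition ergodic :: "('s::countable \<Rightarrow> 's pmf) \<Rightarrow> bool" where
  "ergodic K \<longleftrightarrow> irreducible_chain K \<and> positive_recurrent K"

text \<open>A Markov chain with respect to a filtration, which may be larger than the natural one, so that
  randomized stopping times are covered. The filtration is indexed by \<^typ>\<open>enat\<close> so that the
  library's stopping times may take the value \<open>\<infinity>\<close>.\<close>

locale markov_chain = prob_space M + filtration "space M" F
  for M :: "'a measure" and F :: "enat \<Rightarrow> 'a measure"
    and X :: "nat \<Rightarrow> 'a \<Rightarrow> 's::countable" and K :: "'s \<Rightarrow> 's pmf" +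
  assumes subalgebra_F: "subalgebra M (F t)"
    and adapted: "X n \<in> F (enat n) \<rightarrow>\<^sub>M count_space UNIV"
    and markov: "AE \<omega> in M. real_cond_exp M (F (enat n)) (\<lambda>\<omega>. indicator {y} (X (Suc n) \<omega>)) \<omega>
                   = pmf (K (X n \<omega>)) y"

definition stationary_time ::
    "'a measure \<Rightarrow> (enat \<Rightarrow> 'a measure) \<Rightarrow> (nat \<Rightarrow> 'a \<Rightarrow> 's) \<Rightarrow> 's pmf \<Rightarrow> ('a \<Rightarrow> enat) \<Rightarrow> bool" where
  "stationary_time M F X \<pi> T \<longleftrightarrow>
     stopping_time F T \<and> (AE \<omega> in M. T \<omega> < \<infinity>) \<and>
     distr M (count_space UNIV) (\<lambda>\<omega>. X (the_enat (T \<omega>)) \<omega>) = measure_pmf \<pi>"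

text \<open>The law of \<open>\<pi>\<^sub>i T\<^bsub>\<pi>,i\<^esub>\<close>. The hitting time of an ergodic chain is almost surely finite, so the
  value \<open>0\<close> given to it by \<^const>\<open>enn2real\<close> where it is infinite does not matter.\<close>

definition scaled_hit_law :: "('s::countable \<Rightarrow> 's pmf) \<Rightarrow> 's pmf \<Rightarrow> 's \<Rightarrow> real measure" where
  "scaled_hit_law K \<pi> i =
     distr (path_law K \<pi>) borel (\<lambda>\<omega>. pmf \<pi> i * enn2real (ennreal_of_enat (hit_time i \<omega>)))"

end

theory Submission
  imports Defs
begin

text \<open>
  Write \<open>q = \<pi>\<^sub>i\<close>, \<open>r\<^sub>k = P(T\<^bsub>i,i\<^esub> > k)\<close> and \<open>g\<^sub>k = P(T\<^bsub>\<pi>,i\<^esub> \<ge> k)\<close>. Stationarity gives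
  \<open>g\<^sub>k - g\<^bsub>k+1\<^esub> = q r\<^sub>k\<close>, that is, \<open>g\<^bsub>k+1\<^esub> = (1 - q) g\<^sub>k - q (r\<^sub>k - g\<^sub>k)\<close>, so that \<open>g\<^sub>k\<close> differs from
  the geometric tail \<open>(1 - q)\<^sup>k\<close> by at most \<open>q S\<close> with \<open>S = \<Sum>\<^sub>k \<bar>r\<^sub>k - g\<^sub>k\<bar>\<close>; replacing the geometric tail by
  the exponential one costs another \<open>2 q\<close>. It remains to bound \<open>S\<close> in two ways.

  Decomposing at the last visit to \<open>i\<close> gives
  \<open>r\<^sub>k - g\<^sub>k = \<Sum>\<^bsub>1 \<le> j \<le> k\<^esub> (q - P\<^sup>j\<^bsub>i,i\<^esub>) r\<^bsub>k-j\<^esub>\<close>, and \<open>q \<Sum>\<^sub>k r\<^sub>k \<le> 1\<close>.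

  For a stationary time \<open>T\<close> let \<open>T'\<close> be the time from \<open>T\<close> until the next visit to \<open>i\<close>, which has the law of
  \<open>T\<^bsub>\<pi>,i\<^esub>\<close>. Then \<open>S \<le> E \<bar>T\<^bsub>i,i\<^esub> - (T' + 1)\<bar>\<close>, and the difference is \<open>T - 1\<close> if \<open>0 < T \<le> T\<^bsub>i,i\<^esub>\<close> and at most
  \<open>(T - 1) + T'\<close> if \<open>T\<^bsub>i,i\<^esub> < T\<close>. The event \<open>T = 0\<close>, where the difference is \<open>T\<^bsub>i,i\<^esub> - 1\<close>, has probability at most \<open>q\<close>,
  so its contribution is at most \<open>P(T > 0)\<close>, which is what the terms \<open>T - 1\<close> save against \<open>E T\<close>.
\<close>

section \<open>Avoidance probabilities\<close>

text \<open>\<open>avoid K i k x\<close> is the probability, starting from \<open>x\<close>, of not visiting \<open>i\<close> at the times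
  \<open>0, \<dots>, k - 1\<close>, and \<open>avoid_after K i k x\<close> that of not visiting it at the times \<open>1, \<dots>, k\<close>.\<close>

primrec avoid :: "('s \<Rightarrow> 's pmf) \<Rightarrow> 's \<Rightarrow> nat \<Rightarrow> 's \<Rightarrow> ennreal" where
  "avoid K i 0 x = 1"
| "avoid K i (Suc k) x = indicator (- {i}) x * (\<integral>\<^sup>+ y. avoid K i k y \<partial>K x)"

definition avoid_after :: "('s \<Rightarrow> 's pmf) \<Rightarrow> 's \<Rightarrow> nat \<Rightarrow> 's \<Rightarrow> ennreal" where
  "avoid_after K i k x = (\<integral>\<^sup>+ y. avoid K i k y \<partial>K x)"

lemma avoid_le_1: "avoid K i k x \<le> 1"
proof (induction k arbitrary: x)
  case (Suc k)
  have "(\<integral>\<^sup>+ y. avoid K i k y \<partial>K x) \<le> (\<integral>\<^sup>+ y. 1 \<partial>K x)"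
    by (intro nn_integral_mono Suc.IH)
  then show ?case
    by (auto simp: measure_pmf.emeasure_space_1 split: split_indicator)
qed simp

lemma nn_integral_avoid_le_1: "(\<integral>\<^sup>+ x. avoid K i k x \<partial>measure_pmf \<mu>) \<le> 1"
proof -
  have "(\<integral>\<^sup>+ x. avoid K i k x \<partial>measure_pmf \<mu>) \<le> (\<integral>\<^sup>+ x. 1 \<partial>measure_pmf \<mu>)"
    by (intro nn_integral_mono avoid_le_1)
  then show ?thesis
    by (simp add: measure_pmf.emeasure_space_1)
qed

lemma avoid_after_le_1: "avoid_after K i k x \<le> 1"
  by (simp add: avoid_after_def nn_integral_avoid_le_1)

lemma avoid_after_0: "avoid_after K i 0 x = 1"
  by (simp add: avoid_after_def measure_pmf.emeasure_space_1)

text \<open>Off \<open>i\<close> the two avoidance probabilities coincide; at \<open>i\<close>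
  itself \<open>avoid\<close> vanishes, since time 0 already counts as a visit.\<close>

lemma avoid_after_split:
  "avoid_after K i k x = avoid K i (Suc k) x + indicator {i} x * avoid_after K i k i"
  by (auto simp: avoid_after_def split: split_indicator)

text \<open>Either \<open>i\<close> is not visited at any of the times 0 to \<open>k\<close>, or the
  last such visit is at some time \<open>j\<close>, after which \<open>i\<close> is avoided for
  \<open>k - j\<close> steps. These events form a partition. The induction conditions on the first
  step.\<close>

lemma last_exit_decomposition:
  "avoid K i (Suc k) x
     + (\<Sum>j\<le>k. ennreal (pmf (nstep K j x) i) * avoid_after K i (k - j) i) = 1"
proof (induction k arbitrary: x)
  case 0
  then show ?case
    by (auto simp: avoid_after_0 measure_pmf.emeasure_space_1 split: split_indicator)
next
  case (Suc k)
  have "1 = (\<integral>\<^sup>+ y. avoid K i (Suc k) y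
      + (\<Sum>j\<le>k. ennreal (pmf (nstep K j y) i) * avoid_after K i (k - j) i) \<partial>K x)"
    unfolding Suc.IH by (simp add: measure_pmf.emeasure_space_1)
  also have "\<dots> = avoid_after K i (Suc k) x
      + (\<Sum>j\<le>k. ennreal (pmf (nstep K (Suc j) x) i) * avoid_after K i (k - j) i)"
    by (simp add: avoid_after_def nn_integral_add nn_integral_sum nn_integral_multc ennreal_pmf_bind
        del: avoid.simps)
  \<comment> \<open>Avoiding \<open>i\<close> after time 0 means no visit at all or a last visit at
    time 0; the latter becomes the summand \<open>j = 0\<close>.\<close>
  also have "\<dots> = avoid K i (Suc (Suc k)) x + (ennreal (pmf (nstep K 0 x) i) * avoid_after K i (Suc k) i
      + (\<Sum>j\<le>k. ennreal (pmf (nstep K (Suc j) x) i) * avoid_after K i (k - j) i))"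
    unfolding avoid_after_split[of K i "Suc k" x]
    by (simp add: add.assoc indicator_def del: avoid.simps nstep.simps(2))
  finally show ?case
    by (simp only: sum.atMost_Suc_shift diff_Suc_Suc diff_zero)
qed

section \<open>Invariance and positivity of the stationary distribution\<close>

lemma stationary_nn_integral:
  assumes "stationary K \<pi>"
  shows "(\<integral>\<^sup>+ x. (\<integral>\<^sup>+ y. f y \<partial>K x) \<partial>measure_pmf \<pi>) = (\<integral>\<^sup>+ x. f x \<partial>measure_pmf \<pi>)"
  by (subst (2) assms[unfolded stationary_def, symmetric]) simp

text \<open>Under \<open>\<pi>\<close> the windows from 0 to \<open>k - 1\<close> and from 1 to
  \<open>k\<close> are equally likely to miss \<open>i\<close>. Splitting the second one by whether
  the chain starts in \<open>i\<close> gives the recursion for the hitting tail.\<close>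

lemma stationary_avoid:
  assumes "stationary K \<pi>"
  shows "(\<integral>\<^sup>+ x. avoid K i k x \<partial>measure_pmf \<pi>)
    = (\<integral>\<^sup>+ x. avoid K i (Suc k) x \<partial>measure_pmf \<pi>) + ennreal (pmf \<pi> i) * avoid_after K i k i"
proof -
  have "(\<integral>\<^sup>+ x. avoid K i k x \<partial>measure_pmf \<pi>) = (\<integral>\<^sup>+ x. avoid_after K i k x \<partial>measure_pmf \<pi>)"
    unfolding avoid_after_def by (rule stationary_nn_integral[OF assms, symmetric])
  also have "\<dots> = (\<integral>\<^sup>+ x. avoid K i (Suc k) x + indicator {i} x * avoid_after K i k i \<partial>measure_pmf \<pi>)"
    by (subst avoid_after_split) (rule refl)
  finally show ?thesis
    by (simp add: nn_integral_add nn_integral_multc emeasure_pmf_single del: avoid.simps)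
qed

lemma stationary_nstep:
  assumes "stationary K \<pi>"
  shows "bind_pmf \<pi> (nstep K n) = \<pi>"
proof (induction n)
  case (Suc n)
  have "bind_pmf \<pi> (nstep K (Suc n)) = bind_pmf (bind_pmf \<pi> K) (nstep K n)"
    by (simp add: bind_assoc_pmf nstep.simps(2)[abs_def])
  also have "\<dots> = \<pi>"
    using assms Suc.IH by (simp only: stationary_def)
  finally show ?case .
qed (simp add: bind_return_pmf')

text \<open>Some state \<open>x\<close> is charged by \<open>\<pi>\<close> and leads to
  \<open>i\<close> in some \<open>n\<close> steps, and \<open>\<pi>\<close> is invariant under
  \<open>n\<close> steps.\<close>

lemma stationary_irreducible_pos:
  assumes "irreducible_chain K" "stationary K \<pi>"
  shows "0 < pmf \<pi> i"
proof -
  obtain x where x: "x \<in> set_pmf \<pi>"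
    using set_pmf_not_empty by fastforce
  obtain n where "0 < pmf (nstep K n x) i"
    using assms(1) by (auto simp: irreducible_chain_def)
  then have "i \<in> set_pmf (bind_pmf \<pi> (nstep K n))"
    using x by (auto simp: set_bind_pmf intro!: bexI[of _ x] simp: set_pmf_iff[of i])
  then show ?thesis
    by (simp add: stationary_nstep[OF assms(2)] pmf_positive)
qed

section \<open>Hitting probabilities on path space\<close>

lemma sets_path_law: "sets (path_law K \<mu>) = sets (PiM UNIV (\<lambda>_. count_space UNIV))"
  by (simp add: path_law_def)

lemma space_path_law: "space (path_law K \<mu>) = UNIV"
  using sets_eq_imp_space_eq[OF sets_path_law] by (simp add: space_PiM PiE_UNIV_domain)

text \<open>\<open>path.C K \<mu> 0 n\<close> is the joint law of the first \<open>n\<close>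
  coordinates. The left side treats these on paths and the next \<open>k\<close> by the recursion of
  \<open>avoid\<close>; the induction hands coordinates over one at a time, so \<open>n\<close> has
  to vary. The case wanted later is \<open>n = 0\<close>.\<close>

lemma nn_integral_path_C_avoid:
  fixes K :: "'s::countable \<Rightarrow> 's pmf"
  shows "(\<integral>\<^sup>+ \<omega>. indicator {\<omega>. \<forall>t<n. \<omega> t \<noteq> i} \<omega> * (\<integral>\<^sup>+ x. avoid K i k x \<partial>chain_kernel K \<mu> n \<omega>)
      \<partial>path.C K \<mu> 0 n (\<lambda>_. undefined))
    = (\<integral>\<^sup>+ \<omega>. indicator {\<omega>. \<forall>t<n + k. \<omega> t \<noteq> i} \<omega> \<partial>path.C K \<mu> 0 (n + k) (\<lambda>_. undefined))"
proof (induction k arbitrary: n)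
  case 0
  have "(\<integral>\<^sup>+ x. 1 \<partial>chain_kernel K \<mu> n \<omega>) = 1" for \<omega>
    by (auto simp: chain_kernel_def measure_pmf.emeasure_space_1 split: nat.split)
  then show ?case by simp
next
  case (Suc k)
  let ?u = "\<lambda>_. undefined :: 's"
  let ?P = "\<lambda>n. PiM {0..<n} (\<lambda>_. count_space (UNIV :: 's set))"
  let ?I = "\<lambda>n \<omega>. indicator {\<omega>. \<forall>t<n. \<omega> t \<noteq> i} \<omega> :: ennreal"
  have u: "?u \<in> space (?P 0)" by (simp add: space_PiM PiE_iff extensional_def)
  have sC: "sets (path.C K \<mu> 0 n ?u) = sets (?P n)" 
    using path.sets_C[OF u, of K \<mu> n] by simp
  have m: "(\<lambda>\<omega>. ?I (Suc n) \<omega> * (\<integral>\<^sup>+ x. avoid K i k x \<partial>chain_kernel K \<mu> (Suc n) \<omega>))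
      \<in> borel_measurable (?P (Suc n))"
  proof (rule borel_measurable_times_ennreal)
    show "(\<lambda>\<omega>. \<integral>\<^sup>+ x. avoid K i k x \<partial>chain_kernel K \<mu> (Suc n) \<omega>) \<in> borel_measurable (?P (Suc n))"
      by (rule measurable_compose[OF path.P nn_integral_measurable_subprob_algebra]) simp
    have "indicator {\<omega> \<in> space (?P (Suc n)). \<forall>t\<in>{0..<Suc n}. \<omega> t \<noteq> i} \<in> borel_measurable (?P (Suc n))"
      by measurable
    then show "?I (Suc n) \<in> borel_measurable (?P (Suc n))"
      by (rule measurable_cong[THEN iffD1, rotated]) (auto split: split_indicator)
  qed
  \<comment> \<open>Appending \<open>x\<close> contributes the factor for
    \<open>x \<noteq> i\<close>, and the kernel for coordinate \<open>Suc n\<close> looks only at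
    \<open>x\<close>; together this unfolds \<open>avoid\<close> once.\<close>
  have "?I n \<omega> * (\<integral>\<^sup>+ x. avoid K i (Suc k) x \<partial>chain_kernel K \<mu> n \<omega>)
     = (\<integral>\<^sup>+ \<omega>. ?I (Suc n) \<omega> * (\<integral>\<^sup>+ x. avoid K i k x \<partial>chain_kernel K \<mu> (Suc n) \<omega>) \<partial>path.eP K \<mu> n \<omega>)"
    if \<omega>: "\<omega> \<in> space (?P n)" for \<omega>
  proof -
    have [simp]: "chain_kernel K \<mu> (Suc n) (fun_upd \<omega> n x) = measure_pmf (K x)" for x
      by (simp add: chain_kernel_def)
    have [simp]: "?I (Suc n) (fun_upd \<omega> n x) = ?I n \<omega> * indicator (- {i}) x" for x
      by (auto simp: less_Suc_eq split: split_indicator)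
    have "sets (chain_kernel K \<mu> n \<omega>) = UNIV"
      by (auto simp: chain_kernel_def split: nat.split)
    then have "f \<in> borel_measurable (chain_kernel K \<mu> n \<omega>)" for f :: "_ \<Rightarrow> ennreal"
      by (auto simp: measurable_def)
    then show ?thesis
      by (subst path.nn_integral_eP[OF \<omega> m]) (simp add: avoid.simps(2)[abs_def] nn_integral_cmult mult.assoc)
  qed
  then have "(\<integral>\<^sup>+ \<omega>. ?I n \<omega> * (\<integral>\<^sup>+ x. avoid K i (Suc k) x \<partial>chain_kernel K \<mu> n \<omega>) \<partial>path.C K \<mu> 0 n ?u)
     = (\<integral>\<^sup>+ \<omega>. (\<integral>\<^sup>+ \<omega>. ?I (Suc n) \<omega> * (\<integral>\<^sup>+ x. avoid K i k x \<partial>chain_kernel K \<mu> (Suc n) \<omega>)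
           \<partial>path.eP K \<mu> n \<omega>) \<partial>path.C K \<mu> 0 n ?u)"
    by (intro nn_integral_cong) (simp add: sets_eq_imp_space_eq[OF sC])
  also have "\<dots> = (\<integral>\<^sup>+ \<omega>. ?I (Suc n) \<omega> * (\<integral>\<^sup>+ x. avoid K i k x \<partial>chain_kernel K \<mu> (Suc n) \<omega>)
       \<partial>path.C K \<mu> 0 (Suc n) ?u)"
    using m path.measurable_eP[of K \<mu> n]
    by (simp add: nn_integral_bind[where B = "?P (Suc n)"] measurable_cong_sets[OF sC refl])
  also have "\<dots> = (\<integral>\<^sup>+ \<omega>. ?I (Suc n + k) \<omega> \<partial>path.C K \<mu> 0 (Suc n + k) ?u)"
    by (rule Suc.IH)
  finally show ?case by (simp del: avoid.simps path.C.simps)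
qed

text \<open>The event is a cylinder over the first \<open>k\<close> coordinates, so the projective
  limit reduces it to \<open>path.C\<close>.\<close>

lemma path_law_avoid:
  fixes K :: "'s::countable \<Rightarrow> 's pmf"
  shows "emeasure (path_law K \<mu>) {\<omega>. \<forall>t<k. \<omega> t \<noteq> i} = (\<integral>\<^sup>+ x. avoid K i k x \<partial>measure_pmf \<mu>)"
proof -
  let ?u = "\<lambda>_. undefined :: 's"
  let ?P = "\<lambda>n. PiM {0..<n} (\<lambda>_. count_space (UNIV :: 's set))"
  let ?A = "{\<omega> \<in> space (?P k). \<forall>t\<in>{0..<k}. \<omega> t \<noteq> i}"
  have u: "?u \<in> space (?P 0)" by (simp add: space_PiM PiE_iff extensional_def)
  have A: "?A \<in> sets (?P k)"
    by measurable
  have emb: "{\<omega>. \<forall>t<k. \<omega> t \<noteq> i} = prod_emb UNIV (\<lambda>_. count_space UNIV) {0..<k} ?A"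
    by (auto simp: prod_emb_def space_PiM)
  have sC: "sets (path.C K \<mu> 0 k ?u) = sets (?P k)"
    using path.sets_C[OF u, of K \<mu> k] by simp
  have "emeasure (path_law K \<mu>) {\<omega>. \<forall>t<k. \<omega> t \<noteq> i} = emeasure (path.CI K \<mu> {0..<k}) ?A"
    unfolding emb path_law_def by (rule path.lim[OF _ A]) simp
  also have "\<dots> = emeasure (path.C K \<mu> 0 k ?u) ?A"
    using A by (subst path.emeasure_CI[OF subset_refl A])
      (auto intro!: arg_cong[where f = "emeasure _"] simp: prod_emb_def space_PiM)
  also have "\<dots> = (\<integral>\<^sup>+ \<omega>. indicator {\<omega>. \<forall>t<0 + k. \<omega> t \<noteq> i} \<omega> \<partial>path.C K \<mu> 0 (0 + k) ?u)"
    using A sets_eq_imp_space_eq[OF sC]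
    by (subst nn_integral_indicator[symmetric])
      (auto simp: sC simp del: nn_integral_indicator intro!: nn_integral_cong split: split_indicator)
  also have "\<dots> = (\<integral>\<^sup>+ x. avoid K i k x \<partial>measure_pmf \<mu>)"
    unfolding nn_integral_path_C_avoid[symmetric]
    using u by (simp add: chain_kernel_def nn_integral_return)
  finally show ?thesis .
qed

lemma prob_space_path_law: "prob_space (path_law K \<mu>)"
proof
  \<comment> \<open>The condition is void, so this is the event of all paths.\<close>
  have "emeasure (path_law K \<mu>) {\<omega>. \<forall>t<(0::nat). \<omega> t \<noteq> i} = 1" for i
    by (subst path_law_avoid) (simp add: avoid.simps(1)[abs_def] measure_pmf.emeasure_space_1)
  then show "emeasure (path_law K \<mu>) (space (path_law K \<mu>)) = 1"
    by (simp add: space_path_law)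
qed

section \<open>Hitting times, their tails and their means\<close>

lemma less_hit_time_iff: "enat k < hit_time i \<omega> \<longleftrightarrow> (\<forall>t<Suc k. \<omega> t \<noteq> i)"
proof -
  \<comment> \<open>A strict upper bound on an infimum is witnessed by a member; integrality makes
    the bound strict.\<close>
  have "hit_time i \<omega> \<le> enat k \<longleftrightarrow> hit_time i \<omega> < enat (Suc k)"
    by (cases "hit_time i \<omega>") auto
  also have "\<dots> \<longleftrightarrow> (\<exists>t<Suc k. \<omega> t = i)"
    by (auto simp: hit_time_def Inf_less_iff)
  finally show ?thesis
    by (auto simp: not_le[symmetric])
qed

lemma hit_time_le_return_time: "hit_time i \<omega> \<le> return_time i \<omega>"
  unfolding hit_time_def return_time_def by (intro Inf_superset_mono) auto

text \<open>Every subset of \<open>enat\<close> is Borel, so upper rays decide measurability; the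
  ray above \<infinity> is empty.\<close>

lemma enat_measurable_count_spaceI:
  assumes "\<And>k. {x \<in> space M. enat k < f x} \<in> sets M"
  shows "f \<in> M \<rightarrow>\<^sub>M count_space UNIV"
proof -
  have "f \<in> borel_measurable M"
  proof (rule borel_measurableI_greater)
    show "{x \<in> space M. y < f x} \<in> sets M" for y
      using assms by (cases y) auto
  qed
  then show ?thesis
    by (simp add: measurable_cong_sets[OF refl sets_borel_eq_count_space])
qed

lemma path_avoid_sets: "{\<omega>. \<forall>t<k. \<omega> t \<noteq> i} \<in> sets (path_law K \<mu>)"
proof -
  have "{\<omega> \<in> space (PiM UNIV (\<lambda>_. count_space UNIV)). \<forall>t<k. \<omega> t \<noteq> i}
      \<in> sets (PiM UNIV (\<lambda>_::nat. count_space (UNIV :: 'a set)))"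
    by measurable
  then show ?thesis
    by (simp add: sets_path_law space_PiM PiE_UNIV_domain)
qed

lemma hit_time_measurable: "hit_time i \<in> path_law K \<mu> \<rightarrow>\<^sub>M count_space UNIV"
  by (rule enat_measurable_count_spaceI)
    (simp only: less_hit_time_iff space_path_law UNIV_I simp_thms path_avoid_sets)

text \<open>By the tail-sum formula the left side is the mean hitting time of \<open>i\<close> from
  \<open>j\<close>. For \<open>j = i\<close> it is 0, hence only an inequality.\<close>

lemma sum_avoid_le_mean_return_time: "(\<Sum>k. avoid K i (Suc k) j) \<le> mean_return_time K j i"
proof -
  have "(\<Sum>k. avoid K i (Suc k) j) = (\<integral>\<^sup>+ \<omega>. ennreal_of_enat (hit_time i \<omega>) \<partial>path_law K (return_pmf j))"
    by (simp add: nn_integral_enat_function[OF hit_time_measurable] less_hit_time_iff space_path_law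
        path_law_avoid del: avoid.simps)
  also have "\<dots> \<le> mean_return_time K j i"
    unfolding mean_return_time_def by (intro nn_integral_mono) (simp add: hit_time_le_return_time)
  finally show ?thesis .
qed

section \<open>Markov property at stopping times\<close>

context markov_chain
begin

lemma sets_F: "B \<in> sets (F t) \<Longrightarrow> B \<in> sets M"
  using subalgebra_F by (auto simp: subalgebra_def)

lemma X_measurable [measurable]: "X n \<in> M \<rightarrow>\<^sub>M count_space UNIV"
  using measurable_from_subalg[OF subalgebra_F adapted] .

text \<open>The assumption \<open>markov\<close> concerns indicators of single states. As the state
  space is countable, \<open>f\<close> is a sum of multiples of these, and Tonelli exchanges sum and
  expectation.\<close>

lemma nn_integral_next_state:
  fixes f :: "'s \<Rightarrow> ennreal"
  assumes B: "B \<in> sets (F (enat n))"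
  shows "(\<integral>\<^sup>+ \<omega>. indicator B \<omega> * f (X (Suc n) \<omega>) \<partial>M)
    = (\<integral>\<^sup>+ \<omega>. indicator B \<omega> * (\<integral>\<^sup>+ y. f y \<partial>K (X n \<omega>)) \<partial>M)"
proof -
  have [measurable]: "B \<in> sets M" by (rule sets_F[OF B])
  interpret sub: finite_measure_subalgebra M "F (enat n)"
    by standard (rule subalgebra_F)
  \<comment> \<open>The conditional expectation is real-valued, so the identity is proved for
    Bochner integrals of functions bounded by 1 and carried back.\<close>
  have step: "(\<integral>\<^sup>+ \<omega>. indicator B \<omega> * indicator {y} (X (Suc n) \<omega>) \<partial>M)
      = (\<integral>\<^sup>+ \<omega>. indicator B \<omega> * ennreal (pmf (K (X n \<omega>)) y) \<partial>M)" for y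
  proof -
    let ?f = "\<lambda>\<omega>. indicator {y} (X (Suc n) \<omega>) :: real"
    have int: "integrable M ?f"
      by (rule integrable_const_bound[where B = 1]) auto
    have "(\<integral>\<^sup>+ \<omega>. indicator B \<omega> * indicator {y} (X (Suc n) \<omega>) \<partial>M)
        = (\<integral>\<^sup>+ \<omega>. ennreal (indicator B \<omega> * ?f \<omega>) \<partial>M)"
      by (intro nn_integral_cong) (auto split: split_indicator)
    also have "\<dots> = ennreal (\<integral>\<omega>. indicator B \<omega> * ?f \<omega> \<partial>M)"
      by (intro nn_integral_eq_integral integrable_const_bound[where B = 1]) (auto simp: mult_le_one)
    also have "(\<integral>\<omega>. indicator B \<omega> * ?f \<omega> \<partial>M)
        = (\<integral>\<omega>. indicator B \<omega> * real_cond_exp M (F (enat n)) ?f \<omega> \<partial>M)"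
      using sub.real_cond_exp_intA[OF int B] by (simp add: set_lebesgue_integral_def)
    also have "\<dots> = (\<integral>\<omega>. indicator B \<omega> * pmf (K (X n \<omega>)) y \<partial>M)"
      using markov[of n y] by (intro integral_cong_AE) auto
    also have "ennreal \<dots> = (\<integral>\<^sup>+ \<omega>. ennreal (indicator B \<omega> * pmf (K (X n \<omega>)) y) \<partial>M)"
      by (intro nn_integral_eq_integral[symmetric] integrable_const_bound[where B = 1])
        (auto simp: mult_le_one pmf_le_1)
    also have "\<dots> = (\<integral>\<^sup>+ \<omega>. indicator B \<omega> * ennreal (pmf (K (X n \<omega>)) y) \<partial>M)"
      by (intro nn_integral_cong) (auto split: split_indicator)
    finally show ?thesis .
  qed
  have "(\<integral>\<^sup>+ \<omega>. indicator B \<omega> * f (X (Suc n) \<omega>) \<partial>M)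
      = (\<integral>\<^sup>+ \<omega>. (\<integral>\<^sup>+ y. f y * (indicator B \<omega> * indicator {y} (X (Suc n) \<omega>)) \<partial>count_space UNIV) \<partial>M)"
  proof (intro nn_integral_cong)
    fix \<omega>
    have "(\<integral>\<^sup>+ y. f y * (indicator B \<omega> * indicator {y} (X (Suc n) \<omega>)) \<partial>count_space UNIV)
        = (\<integral>\<^sup>+ y. indicator B \<omega> * f y * indicator {X (Suc n) \<omega>} y \<partial>count_space UNIV)"
      by (intro nn_integral_cong) (auto split: split_indicator)
    also have "\<dots> = indicator B \<omega> * f (X (Suc n) \<omega>)"
      by (subst nn_integral_indicator_singleton) auto
    finally show "indicator B \<omega> * f (X (Suc n) \<omega>)
      = (\<integral>\<^sup>+ y. f y * (indicator B \<omega> * indicator {y} (X (Suc n) \<omega>)) \<partial>count_space UNIV)" ..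
  qed
  also have "\<dots> = (\<integral>\<^sup>+ y. (\<integral>\<^sup>+ \<omega>. f y * (indicator B \<omega> * indicator {y} (X (Suc n) \<omega>)) \<partial>M) \<partial>count_space UNIV)"
    by (rule nn_integral_count_space_nn_integral) auto
  also have "\<dots> = (\<integral>\<^sup>+ y. (\<integral>\<^sup>+ \<omega>. f y * (indicator B \<omega> * ennreal (pmf (K (X n \<omega>)) y)) \<partial>M) \<partial>count_space UNIV)"
    by (simp add: nn_integral_cmult step)
  also have "\<dots> = (\<integral>\<^sup>+ \<omega>. (\<integral>\<^sup>+ y. f y * (indicator B \<omega> * ennreal (pmf (K (X n \<omega>)) y)) \<partial>count_space UNIV) \<partial>M)"
    by (rule nn_integral_count_space_nn_integral[symmetric]) auto
  also have "\<dots> = (\<integral>\<^sup>+ \<omega>. indicator B \<omega> * (\<integral>\<^sup>+ y. f y \<partial>K (X n \<omega>)) \<partial>M)"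
    by (simp add: nn_integral_measure_pmf nn_integral_cmult[symmetric] mult_ac)
  finally show ?thesis .
qed

text \<open>The condition at time \<open>n\<close> is absorbed into \<open>B\<close>, which stays in
  the filtration at \<open>Suc n\<close>; the induction hypothesis is applied there and followed by
  one step of the chain. Hence \<open>n\<close> and \<open>B\<close> are arbitrary.\<close>

lemma nn_integral_avoid_from:
  assumes "B \<in> sets (F (enat n))"
  shows "(\<integral>\<^sup>+ \<omega>. indicator B \<omega> * indicator {\<omega>. \<forall>t<k. X (n + t) \<omega> \<noteq> i} \<omega> \<partial>M)
    = (\<integral>\<^sup>+ \<omega>. indicator B \<omega> * avoid K i k (X n \<omega>) \<partial>M)"
  using assms
proof (induction k arbitrary: n B)
  case 0
  then show ?case by simp
next
  case (Suc k)
  define B' where "B' = {\<omega> \<in> space (F (enat n)). \<omega> \<in> B \<and> X n \<omega> \<noteq> i}"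
  note adapted [measurable] note Suc.prems [measurable]
  have B': "B' \<in> sets (F (enat n))"
    unfolding B'_def by measurable
  have B'_Suc: "B' \<in> sets (F (enat (Suc n)))"
    using B' sets_F_mono[of "enat n" "enat (Suc n)"] by auto
  have "B \<subseteq> space (F (enat n))"
    using sets.sets_into_space[OF Suc.prems] .
  then have B'_iff: "\<omega> \<in> B' \<longleftrightarrow> \<omega> \<in> B \<and> X n \<omega> \<noteq> i" for \<omega>
    by (auto simp: B'_def)
  have "(\<forall>t<Suc k. X (n + t) \<omega> \<noteq> i) \<longleftrightarrow> X n \<omega> \<noteq> i \<and> (\<forall>t<k. X (Suc n + t) \<omega> \<noteq> i)" for \<omega>
    by (auto simp: less_Suc_eq_0_disj)
  then have "(\<integral>\<^sup>+ \<omega>. indicator B \<omega> * indicator {\<omega>. \<forall>t<Suc k. X (n + t) \<omega> \<noteq> i} \<omega> \<partial>M)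
      = (\<integral>\<^sup>+ \<omega>. indicator B' \<omega> * indicator {\<omega>. \<forall>t<k. X (Suc n + t) \<omega> \<noteq> i} \<omega> \<partial>M)"
    by (intro nn_integral_cong) (simp add: indicator_def B'_iff)
  also have "\<dots> = (\<integral>\<^sup>+ \<omega>. indicator B' \<omega> * avoid K i k (X (Suc n) \<omega>) \<partial>M)"
    by (rule Suc.IH[OF B'_Suc])
  also have "\<dots> = (\<integral>\<^sup>+ \<omega>. indicator B' \<omega> * (\<integral>\<^sup>+ y. avoid K i k y \<partial>K (X n \<omega>)) \<partial>M)"
    by (rule nn_integral_next_state[OF B'])
  also have "\<dots> = (\<integral>\<^sup>+ \<omega>. indicator B \<omega> * avoid K i (Suc k) (X n \<omega>) \<partial>M)"
    by (intro nn_integral_cong) (simp add: indicator_def B'_iff)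
  finally show ?case .
qed

lemma nn_integral_avoid_after:
  assumes "B \<in> sets (F (enat n))"
  shows "(\<integral>\<^sup>+ \<omega>. indicator B \<omega> * indicator {\<omega>. \<forall>t<k. X (Suc (n + t)) \<omega> \<noteq> i} \<omega> \<partial>M)
    = (\<integral>\<^sup>+ \<omega>. indicator B \<omega> * avoid_after K i k (X n \<omega>) \<partial>M)"
proof -
  have "B \<in> sets (F (enat (Suc n)))"
    using assms sets_F_mono[of "enat n" "enat (Suc n)"] by auto
  then show ?thesis
    using nn_integral_avoid_from[of B "Suc n" k i] nn_integral_next_state[OF assms, of "avoid K i k"]
    by (simp add: avoid_after_def)
qed

section \<open>Decomposition over the values of a stopping time\<close>

lemma stopping_time_eq_sets:
  assumes "stopping_time F T"
  shows "{\<omega> \<in> space M. T \<omega> = enat n} \<in> sets (F (enat n))"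
  using stopping_time_eq_const[OF assms, of "enat n"] by (simp add: pred_def space_F)

lemma stopping_time_measurable:
  assumes T: "stopping_time F T"
  shows "T \<in> M \<rightarrow>\<^sub>M count_space UNIV"
proof (subst measurable_count_space_eq2_countable, safe)
  fix t
  have "{\<omega> \<in> space M. T \<omega> = t} \<in> sets M"
    using stopping_time_eq_const[OF T, of t] by (intro sets_F[of _ t]) (simp add: pred_def space_F)
  also have "{\<omega> \<in> space M. T \<omega> = t} = T -` {t} \<inter> space M" by auto
  finally show "T -` {t} \<inter> space M \<in> sets M" .
qed auto

lemma state_at_measurable:
  assumes "stopping_time F T"
  shows "(\<lambda>\<omega>. X (the_enat (T \<omega>) + t) \<omega>) \<in> M \<rightarrow>\<^sub>M count_space UNIV"
  by (rule measurable_compose_countable[where f = "\<lambda>n \<omega>. X (the_enat n + t) \<omega>" and g = T])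
    (auto intro: stopping_time_measurable[OF assms])

lemma nn_integral_split_stopping_time:
  assumes T: "stopping_time F T" and fin: "AE \<omega> in M. T \<omega> < \<infinity>"
    and f: "f \<in> borel_measurable M"
  shows "(\<integral>\<^sup>+ \<omega>. f \<omega> \<partial>M) = (\<Sum>n. \<integral>\<^sup>+ \<omega>. indicator {\<omega> \<in> space M. T \<omega> = enat n} \<omega> * f \<omega> \<partial>M)"
proof -
  note f [measurable]
  have [measurable]: "{\<omega> \<in> space M. T \<omega> = enat n} \<in> sets M" for n
    using sets_F[OF stopping_time_eq_sets[OF T]] .
  have "(\<integral>\<^sup>+ \<omega>. f \<omega> \<partial>M) = (\<integral>\<^sup>+ \<omega>. (\<Sum>n. indicator {\<omega> \<in> space M. T \<omega> = enat n} \<omega> * f \<omega>) \<partial>M)"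
  proof (rule nn_integral_cong_AE)
    show "AE \<omega> in M. f \<omega> = (\<Sum>n. indicator {\<omega> \<in> space M. T \<omega> = enat n} \<omega> * f \<omega>)"
      using fin AE_space
    proof eventually_elim
      case (elim \<omega>)
      then obtain m where m: "T \<omega> = enat m" by auto
      have "(\<Sum>n. indicator {\<omega> \<in> space M. T \<omega> = enat n} \<omega> * f \<omega>)
          = (\<Sum>n\<in>{m}. indicator {\<omega> \<in> space M. T \<omega> = enat n} \<omega> * f \<omega>)"
        using m by (intro suminf_finite) auto
      with m elim show ?case by simp
    qed
  qed
  also have "\<dots> = (\<Sum>n. \<integral>\<^sup>+ \<omega>. indicator {\<omega> \<in> space M. T \<omega> = enat n} \<omega> * f \<omega> \<partial>M)"
    by (rule nn_integral_suminf) measurable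
  finally show ?thesis .
qed

text \<open>The hypotheses on \<open>B\<close> say that it belongs to the past of \<open>T\<close>.
  On each event \<open>T = n\<close> the claim is the Markov property at the fixed time
  \<open>n\<close>, and finiteness of \<open>T\<close> lets these pieces add up.\<close>

lemma strong_markov_avoid:
  assumes T: "stopping_time F T" and fin: "AE \<omega> in M. T \<omega> < \<infinity>"
    and B: "\<And>n. {\<omega> \<in> B. T \<omega> = enat n} \<in> sets (F (enat n))" and BM: "B \<in> sets M"
  shows "(\<integral>\<^sup>+ \<omega>. indicator B \<omega> * indicator {\<omega>. \<forall>t<k. X (the_enat (T \<omega>) + t) \<omega> \<noteq> i} \<omega> \<partial>M)
    = (\<integral>\<^sup>+ \<omega>. indicator B \<omega> * avoid K i k (X (the_enat (T \<omega>)) \<omega>) \<partial>M)"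
proof -
  note BM [measurable]
  note state_at_measurable[OF T, measurable]
  have [measurable]: "(\<lambda>\<omega>. X (the_enat (T \<omega>)) \<omega>) \<in> M \<rightarrow>\<^sub>M count_space UNIV"
    using state_at_measurable[OF T, of 0] by simp
  have [measurable]: "(\<lambda>\<omega>. indicator {\<omega>. \<forall>t<k. X (the_enat (T \<omega>) + t) \<omega> \<noteq> i} \<omega> :: ennreal)
      \<in> borel_measurable M"
    unfolding indicator_def mem_Collect_eq by measurable
  have "(\<integral>\<^sup>+ \<omega>. indicator {\<omega> \<in> space M. T \<omega> = enat n} \<omega>
        * (indicator B \<omega> * indicator {\<omega>. \<forall>t<k. X (the_enat (T \<omega>) + t) \<omega> \<noteq> i} \<omega>) \<partial>M)
      = (\<integral>\<^sup>+ \<omega>. indicator {\<omega> \<in> space M. T \<omega> = enat n} \<omega>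
        * (indicator B \<omega> * avoid K i k (X (the_enat (T \<omega>)) \<omega>)) \<partial>M)" (is "?l n = ?r n") for n
  proof -
    have "?l n = (\<integral>\<^sup>+ \<omega>. indicator {\<omega> \<in> B. T \<omega> = enat n} \<omega>
        * indicator {\<omega>. \<forall>t<k. X (n + t) \<omega> \<noteq> i} \<omega> \<partial>M)"
      by (intro nn_integral_cong) (auto split: split_indicator)
    also have "\<dots> = (\<integral>\<^sup>+ \<omega>. indicator {\<omega> \<in> B. T \<omega> = enat n} \<omega> * avoid K i k (X n \<omega>) \<partial>M)"
      by (rule nn_integral_avoid_from[OF B])
    also have "\<dots> = ?r n"
      by (intro nn_integral_cong) (auto split: split_indicator)
    finally show ?thesis .
  qed
  then show ?thesis
    by (subst (1 2) nn_integral_split_stopping_time[OF T fin]) auto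
qed

end

section \<open>Tails of the return and hitting times\<close>

text \<open>This and \<open>hit_tail\<close> are the sequences r and g of the introduction. They are
  real because differences are formed below; being at most 1, they lose nothing under
  \<open>enn2real\<close>.\<close>

definition ret_tail :: "('s \<Rightarrow> 's pmf) \<Rightarrow> 's \<Rightarrow> nat \<Rightarrow> real" where
  "ret_tail K i k = enn2real (avoid_after K i k i)"

definition hit_tail :: "('s \<Rightarrow> 's pmf) \<Rightarrow> 's pmf \<Rightarrow> 's \<Rightarrow> nat \<Rightarrow> real" where
  "hit_tail K \<pi> i k = enn2real (\<integral>\<^sup>+ x. avoid K i k x \<partial>measure_pmf \<pi>)"

lemma ennreal_ret_tail: "ennreal (ret_tail K i k) = avoid_after K i k i"
  unfolding ret_tail_def 
  by (intro ennreal_enn2real le_less_trans[OF avoid_after_le_1 ennreal_one_less_top])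

lemma ennreal_hit_tail: "ennreal (hit_tail K \<pi> i k) = (\<integral>\<^sup>+ x. avoid K i k x \<partial>measure_pmf \<pi>)"
  unfolding hit_tail_def 
  by (intro ennreal_enn2real le_less_trans[OF nn_integral_avoid_le_1 ennreal_one_less_top])

lemma ret_tail_nonneg: "0 \<le> ret_tail K i k"
  by (simp add: ret_tail_def)

lemma hit_tail_nonneg: "0 \<le> hit_tail K \<pi> i k"
  by (simp add: hit_tail_def)

lemma ret_tail_0: "ret_tail K i 0 = 1"
  by (simp add: ret_tail_def avoid_after_0)

lemma hit_tail_0: "hit_tail K \<pi> i 0 = 1"
  by (simp add: hit_tail_def avoid.simps(1)[abs_def] measure_pmf.emeasure_space_1)

lemma hit_tail_Suc:
  assumes "stationary K \<pi>"
  shows "hit_tail K \<pi> i (Suc k) = hit_tail K \<pi> i k - pmf \<pi> i * ret_tail K i k"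
proof -
  have "ennreal (hit_tail K \<pi> i k) = ennreal (hit_tail K \<pi> i (Suc k) + pmf \<pi> i * ret_tail K i k)"
    using stationary_avoid[OF assms, of i k]
    by (simp add: ennreal_hit_tail[symmetric] ennreal_ret_tail[symmetric] hit_tail_nonneg ret_tail_nonneg
        ennreal_mult del: avoid.simps)
  then show ?thesis
    by (subst (asm) ennreal_inj) (auto simp: hit_tail_nonneg ret_tail_nonneg)
qed

lemma hit_tail_eq_sum:
  assumes "stationary K \<pi>"
  shows "hit_tail K \<pi> i k = 1 - pmf \<pi> i * (\<Sum>j<k. ret_tail K i j)"
  by (induction k) (simp_all add: hit_tail_0 hit_tail_Suc[OF assms] algebra_simps)

text \<open>One half of Kac's formula: \<open>pmf \<pi> i\<close> times a partial sum is 1 minus a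
  hitting tail, hence at most 1.\<close>

lemma ret_tail_summable:
  assumes "stationary K \<pi>" "0 < pmf \<pi> i"
  shows "summable (ret_tail K i)" and "pmf \<pi> i * (\<Sum>k. ret_tail K i k) \<le> 1"
proof -
  have *: "(\<Sum>j<k. ret_tail K i j) \<le> 1 / pmf \<pi> i" for k
    using hit_tail_nonneg[of K \<pi> i k] assms(2)
    by (simp add: hit_tail_eq_sum[OF assms(1)] field_simps)
  show s: "summable (ret_tail K i)"
    by (rule bounded_imp_summable[OF ret_tail_nonneg *[of "Suc _", unfolded lessThan_Suc_atMost]])
  show "pmf \<pi> i * (\<Sum>k. ret_tail K i k) \<le> 1"
    using suminf_le_const[OF s *] assms(2) by (simp add: field_simps)
qed

text \<open>In the last exit decomposition from \<open>i\<close> the event of no visit is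
  empty.\<close>

lemma ret_tail_renewal:
  "(\<Sum>j\<le>k. pmf (nstep K j i) i * ret_tail K i (k - j)) = 1"
proof -
  have "ennreal (\<Sum>j\<le>k. pmf (nstep K j i) i * ret_tail K i (k - j)) = 1"
    using last_exit_decomposition[of K i k i]
    by (simp add: ennreal_ret_tail[symmetric] ret_tail_nonneg ennreal_mult''[symmetric] sum_ennreal)
  then show ?thesis by simp
qed

section \<open>Gap between the two tails and its renewal bound\<close>

text \<open>The index is shifted by one because the tails agree at \<open>0\<close>.\<close>

definition tail_gap :: "('s \<Rightarrow> 's pmf) \<Rightarrow> 's pmf \<Rightarrow> 's \<Rightarrow> nat \<Rightarrow> real" where
  "tail_gap K \<pi> i k = \<bar>ret_tail K i (Suc k) - hit_tail K \<pi> i (Suc k)\<bar>"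

lemma tail_gap_nonneg: "0 \<le> tail_gap K \<pi> i k"
  by (simp add: tail_gap_def)

text \<open>Both tails are 1 minus a convolution with \<open>ret_tail\<close>: of the return
  probabilities in one case, of the constant \<open>pmf \<pi> i\<close> in the other.\<close>

lemma tail_gap_le_convolution:
  assumes "stationary K \<pi>"
  shows "tail_gap K \<pi> i k
    \<le> (\<Sum>j\<le>k. \<bar>pmf (nstep K (Suc j) i) i - pmf \<pi> i\<bar> * ret_tail K i (k - j))"
proof -
  \<comment> \<open>The summand \<open>j = 0\<close> is the return tail itself, as the chain is at
    \<open>i\<close> at time 0.\<close>
  have "1 = ret_tail K i (Suc k) + (\<Sum>j\<le>k. pmf (nstep K (Suc j) i) i * ret_tail K i (k - j))"
    using ret_tail_renewal[of K i "Suc k"]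
    by (subst (asm) sum.atMost_Suc_shift) (simp del: nstep.simps(2))
  moreover have "hit_tail K \<pi> i (Suc k) = 1 - pmf \<pi> i * (\<Sum>j\<le>k. ret_tail K i (k - j))"
    by (simp only: hit_tail_eq_sum[OF assms] lessThan_Suc_atMost)
      (subst sum.atLeastAtMost_rev[of _ 0 k, folded atMost_atLeast0], simp)
  ultimately have "ret_tail K i (Suc k) - hit_tail K \<pi> i (Suc k)
      = (\<Sum>j\<le>k. (pmf \<pi> i - pmf (nstep K (Suc j) i) i) * ret_tail K i (k - j))"
    by (simp add: left_diff_distrib sum_subtractf sum_distrib_left del: nstep.simps(2))
  then have "tail_gap K \<pi> i k
      \<le> (\<Sum>j\<le>k. \<bar>(pmf \<pi> i - pmf (nstep K (Suc j) i) i) * ret_tail K i (k - j)\<bar>)"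
    by (simp only: tail_gap_def sum_abs)
  then show ?thesis
    by (simp only: abs_mult abs_of_nonneg[OF ret_tail_nonneg] abs_minus_commute)
qed

text \<open>Summing the convolution gives a product of sums, in which \<open>pmf \<pi> i\<close>
  times the sum of \<open>ret_tail\<close> is at most 1.\<close>

lemma tail_gap_le_renewal_sum:
  assumes "stationary K \<pi>" "0 < pmf \<pi> i"
  shows "ennreal (pmf \<pi> i) * (\<Sum>k. ennreal (tail_gap K \<pi> i k))
    \<le> (\<Sum>n. ennreal \<bar>pmf (nstep K (Suc n) i) i - pmf \<pi> i\<bar>)"
proof (cases "(\<Sum>n. ennreal \<bar>pmf (nstep K (Suc n) i) i - pmf \<pi> i\<bar>) = top")
  case False
  define d where "d = (\<lambda>n. \<bar>pmf (nstep K (Suc n) i) i - pmf \<pi> i\<bar>)"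
  have d: "summable d" "\<And>n. 0 \<le> d n"
    using False by (auto simp: d_def intro!: summable_suminf_not_top)
  note r = ret_tail_summable[OF assms]
  let ?c = "\<lambda>k. \<Sum>j\<le>k. d j * ret_tail K i (k - j)"
  have c: "?c sums (suminf d * suminf (ret_tail K i))"
    using d r(1) ret_tail_nonneg[of K i] by (intro Cauchy_product_sums) auto
  have "(\<Sum>k. ennreal (tail_gap K \<pi> i k)) \<le> (\<Sum>k. ennreal (?c k))"
    unfolding d_def by (intro suminf_le ennreal_leI tail_gap_le_convolution[OF assms(1)]) auto
  also have "\<dots> = ennreal (suminf d * suminf (ret_tail K i))"
    using d ret_tail_nonneg[of K i] by (intro suminf_ennreal_eq[OF _ c] sum_nonneg) auto
  finally have "ennreal (pmf \<pi> i) * (\<Sum>k. ennreal (tail_gap K \<pi> i k))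
      \<le> ennreal (pmf \<pi> i) * ennreal (suminf d * suminf (ret_tail K i))"
    by (rule mult_left_mono) simp
  also have "\<dots> = ennreal (suminf d * (pmf \<pi> i * suminf (ret_tail K i)))"
    by (simp add: ennreal_mult'[symmetric] mult_ac)
  also have "\<dots> \<le> ennreal (suminf d)"
    using r(2) suminf_nonneg[OF d] by (intro ennreal_leI mult_left_le) auto
  also have "\<dots> = (\<Sum>n. ennreal (d n))"
    using d by (simp add: suminf_ennreal2)
  finally show ?thesis
    by (simp only: d_def)
qed simp

text \<open>The hitting tail obeys the geometric recursion up to the perturbation
  \<open>pmf \<pi> i\<close> times the gap. Earlier errors are multiplied by
  \<open>1 - pmf \<pi> i\<close>, so errors at most add up.\<close>

lemma hit_tail_geometric:
  assumes "stationary K \<pi>" "summable (tail_gap K \<pi> i)"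
  shows "\<bar>hit_tail K \<pi> i k - (1 - pmf \<pi> i) ^ k\<bar> \<le> pmf \<pi> i * (\<Sum>k. tail_gap K \<pi> i k)"
proof -
  let ?q = "pmf \<pi> i" and ?g = "hit_tail K \<pi> i" and ?r = "ret_tail K i"
  have "\<bar>?g k - (1 - ?q) ^ k\<bar> \<le> ?q * (\<Sum>j<k. \<bar>?r j - ?g j\<bar>)"
  proof (induction k)
    case (Suc k)
    have "?g (Suc k) - (1 - ?q) ^ Suc k = (1 - ?q) * (?g k - (1 - ?q) ^ k) - ?q * (?r k - ?g k)"
      by (simp add: hit_tail_Suc[OF assms(1)] algebra_simps)
    also have "\<bar>\<dots>\<bar> \<le> \<bar>(1 - ?q) * (?g k - (1 - ?q) ^ k)\<bar> + \<bar>?q * (?r k - ?g k)\<bar>"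
      by (rule abs_triangle_ineq4)
    also have "\<dots> \<le> \<bar>?g k - (1 - ?q) ^ k\<bar> + ?q * \<bar>?r k - ?g k\<bar>"
      by (intro add_mono) (auto simp: abs_mult pmf_le_1 mult_left_le_one_le)
    also have "\<dots> \<le> ?q * (\<Sum>j<Suc k. \<bar>?r j - ?g j\<bar>)"
      using Suc by (simp add: algebra_simps)
    finally show ?case .
  qed (simp add: hit_tail_0)
  \<comment> \<open>The summand \<open>j = 0\<close> vanishes because both tails start at 1.\<close>
  also have "(\<Sum>j<k. \<bar>?r j - ?g j\<bar>) \<le> (\<Sum>k. tail_gap K \<pi> i k)"
  proof (cases k)
    case 0
    then show ?thesis
      using assms(2) by (simp add: suminf_nonneg tail_gap_nonneg)
  next
    case (Suc m)
    then have "(\<Sum>j<k. \<bar>?r j - ?g j\<bar>) = (\<Sum>j<m. tail_gap K \<pi> i j)"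
      by (simp only: sum.lessThan_Suc_shift) (simp add: hit_tail_0 ret_tail_0 tail_gap_def)
    also have "\<dots> \<le> (\<Sum>k. tail_gap K \<pi> i k)"
      using assms(2) by (intro sum_le_suminf) (auto simp: tail_gap_nonneg)
    finally show ?thesis .
  qed
  finally show ?thesis
    by (simp add: mult_left_mono)
qed

section \<open>From the geometric tail to the exponential law\<close>

lemma exp_minus_le_geometric:
  fixes q :: real
  assumes "0 \<le> q" "q \<le> 1"
  shows "exp (- (q * real m)) \<le> (1 - q) ^ m + q"
proof (induction m)
  case (Suc m)
  have "exp (- q) \<le> 1 / (1 + q)"
    using exp_ge_add_one_self[of q] assms by (simp add: exp_minus field_simps)
  \<comment> \<open>Indeed (1 + q)(1 - q + q^2) = 1 + q^3.\<close>
  also have "\<dots> \<le> 1 - q + q ^ 2"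
    using assms by (simp add: field_simps power2_eq_square)
  finally have q: "exp (- q) - (1 - q) \<le> q ^ 2" by simp
  have "exp (- (q * real (Suc m))) = (1 - q) * exp (- (q * real m)) + exp (- (q * real m)) * (exp (- q) - (1 - q))"
    by (simp add: algebra_simps exp_add[symmetric])
  \<comment> \<open>An error \<open>e\<close> becomes at most \<open>(1 - q) * e + q ^ 2\<close>.
    The fixed point of this map is \<open>q\<close>, so the constant does not grow with
    \<open>m\<close>.\<close>
  also have "\<dots> \<le> (1 - q) * ((1 - q) ^ m + q) + 1 * q ^ 2"
  proof (intro add_mono mult_left_mono Suc.IH)
    have "exp (- (q * real m)) * (exp (- q) - (1 - q)) \<le> exp (- (q * real m)) * q ^ 2"
      using q by (intro mult_left_mono) auto
    also have "\<dots> \<le> 1 * q ^ 2"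
      using assms by (intro mult_right_mono) auto
    finally show "exp (- (q * real m)) * (exp (- q) - (1 - q)) \<le> 1 * q ^ 2" .
  qed (use assms in auto)
  also have "\<dots> = (1 - q) ^ Suc m + q"
    by (simp add: algebra_simps power2_eq_square)
  finally show ?case .
qed (use assms in auto)

text \<open>With \<open>k\<close> the rounded-down \<open>z / q\<close>, the point \<open>z\<close>
  lies between \<open>q * k\<close> and \<open>q * (k + 1)\<close>. One \<open>q\<close> pays for
  passing from exponential to geometric at \<open>k\<close>, the other for the geometric step from
  \<open>k\<close> to \<open>Suc k\<close>.\<close>

lemma exp_minus_geometric_floor:
  fixes q z :: real
  assumes q: "0 < q" "q \<le> 1" and z: "0 \<le> z"
  shows "\<bar>exp (- z) - (1 - q) ^ Suc (nat \<lfloor>z / q\<rfloor>)\<bar> \<le> 2 * q"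
proof -
  define k where "k = nat \<lfloor>z / q\<rfloor>"
  have "real k \<le> z / q" "z / q < real k + 1"
    using q z by (auto simp: k_def of_nat_nat)
  then have k: "q * real k \<le> z" "z \<le> q * real (Suc k)"
    using q by (auto simp: field_simps)
  have "(1 - q) ^ Suc k \<le> exp (- q) ^ Suc k"
    using q exp_ge_add_one_self[of "- q"] by (intro power_mono) auto
  also have "\<dots> = exp (- (q * real (Suc k)))"
    by (subst exp_of_nat_mult[symmetric]) (simp add: mult.commute)
  also have "\<dots> \<le> exp (- z)"
    using k by simp
  finally have lower: "(1 - q) ^ Suc k \<le> exp (- z)" .
  have "exp (- z) \<le> exp (- (q * real k))"
    using k by simp
  also have "\<dots> \<le> (1 - q) ^ k + q"
    using q by (intro exp_minus_le_geometric) auto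
  also have "(1 - q) ^ k = (1 - q) ^ Suc k + q * (1 - q) ^ k"
    by (simp add: algebra_simps)
  also have "q * (1 - q) ^ k \<le> q"
    using q by (intro mult_left_le power_le_one) auto
  finally show ?thesis
    using lower by (simp add: k_def)
qed

text \<open>The hypothesis \<open>lim\<close> makes the hitting time almost surely finite; otherwise
  \<open>enn2real\<close> would move the mass at \<infinity> to 0. For finite values, integrality
  turns the bound \<open>z\<close> into a bound by the floor.\<close>

lemma measure_scaled_hit_law_atMost:
  assumes q: "0 < pmf \<pi> i" and z: "0 \<le> z" and lim: "hit_tail K \<pi> i \<longlonglongrightarrow> 0"
  shows "measure (scaled_hit_law K \<pi> i) {..z} = 1 - hit_tail K \<pi> i (Suc (nat \<lfloor>z / pmf \<pi> i\<rfloor>))"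
proof -
  interpret prob_space "path_law K \<pi>" by (rule prob_space_path_law)
  define k where "k = nat \<lfloor>z / pmf \<pi> i\<rfloor>"
  let ?H = "\<lambda>\<omega>. pmf \<pi> i * enn2real (ennreal_of_enat (hit_time i \<omega>))"
  let ?A = "\<lambda>k. {\<omega>. \<forall>t<k. \<omega> t \<noteq> i}"
  note hit_time_measurable[measurable] path_avoid_sets[measurable]
  have tail: "prob (?A k) = hit_tail K \<pi> i k" for k
    by (simp add: measure_def path_law_avoid hit_tail_def)
  have "prob {\<omega>. hit_time i \<omega> = \<infinity>} \<le> hit_tail K \<pi> i k" for k
    unfolding tail[symmetric]
  proof (rule finite_measure_mono)
    show "{\<omega>. hit_time i \<omega> = \<infinity>} \<subseteq> ?A k"
    proof -
      have "\<omega> t \<noteq> i" if "hit_time i \<omega> = \<infinity>" for \<omega> t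
        using less_hit_time_iff[of t i \<omega>] that by auto
      then show ?thesis by auto
    qed
  qed measurable
  then have "prob {\<omega>. hit_time i \<omega> = \<infinity>} \<le> 0"
    using LIMSEQ_le_const[OF lim] by blast
  moreover have inf: "{\<omega>. hit_time i \<omega> = \<infinity>} \<in> sets (path_law K \<pi>)"
    using measurable_sets[OF hit_time_measurable, of "{\<infinity>}" i K \<pi>]
    by (simp add: space_path_law vimage_def)
  ultimately have fin: "AE \<omega> in path_law K \<pi>. hit_time i \<omega> \<noteq> \<infinity>"
    by (intro AE_I[of _ _ "{\<omega>. hit_time i \<omega> = \<infinity>}"]) (auto simp: emeasure_eq_measure space_path_law measure_le_0_iff)
  have "?H \<in> borel_measurable (path_law K \<pi>)"
    by measurable
  then have "measure (scaled_hit_law K \<pi> i) {..z} = prob (?H -` {..z} \<inter> space (path_law K \<pi>))"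
    unfolding scaled_hit_law_def by (intro measure_distr) auto
  also have "\<dots> = prob (space (path_law K \<pi>) - ?A (Suc k))"
  proof (rule measure_eq_AE)
    show "AE \<omega> in path_law K \<pi>. (\<omega> \<in> ?H -` {..z} \<inter> space (path_law K \<pi>))
        = (\<omega> \<in> space (path_law K \<pi>) - ?A (Suc k))"
      using fin
    proof eventually_elim
      case (elim \<omega>)
      then obtain m where m: "hit_time i \<omega> = enat m" by auto
      have "pmf \<pi> i * real m \<le> z \<longleftrightarrow> real m \<le> z / pmf \<pi> i"
        using q by (simp add: field_simps)
      also have "\<dots> \<longleftrightarrow> m \<le> k"
        using q z by (simp add: k_def le_nat_iff le_floor_iff)
      also have "\<dots> \<longleftrightarrow> \<not> enat k < hit_time i \<omega>"
        using m by auto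
      finally show ?case
        unfolding less_hit_time_iff by (auto simp: m space_path_law)
    qed
  qed (auto intro!: measurable_sets[OF \<open>?H \<in> borel_measurable (path_law K \<pi>)\<close>])
  also have "\<dots> = 1 - hit_tail K \<pi> i (Suc k)"
    by (subst prob_compl) (simp_all only: tail path_avoid_sets)
  finally show ?thesis by (simp add: k_def)
qed

text \<open>For \<open>z \<ge> 0\<close> the geometric tail at the floor of
  \<open>z / pmf \<pi> i\<close> plus one is the intermediate term of a triangle inequality; for
  negative \<open>z\<close> both distribution functions are 0.\<close>

lemma kolmogorov_dist_hit_le:
  assumes st: "stationary K \<pi>" and q: "0 < pmf \<pi> i" and s: "summable (tail_gap K \<pi> i)"
  shows "kolmogorov_dist (scaled_hit_law K \<pi> i) (density lborel (exponential_density 1))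
    \<le> 2 * pmf \<pi> i + pmf \<pi> i * (\<Sum>k. tail_gap K \<pi> i k)"
  unfolding kolmogorov_dist_def
proof (rule cSUP_least)
  fix z :: real
  let ?q = "pmf \<pi> i"
  let ?b = "2 * ?q + ?q * (\<Sum>k. tail_gap K \<pi> i k)"
  have b: "0 \<le> ?b"
    using q s by (intro add_nonneg_nonneg mult_nonneg_nonneg suminf_nonneg) (auto simp: tail_gap_nonneg)
  \<comment> \<open>The hitting tail tends to 0 because both the gap and the return tail are
    summable.\<close>
  have "(\<lambda>k. ret_tail K i (Suc k) - hit_tail K \<pi> i (Suc k)) \<longlonglongrightarrow> 0"
    using summable_LIMSEQ_zero[OF s] by (simp add: tail_gap_def[abs_def] tendsto_rabs_zero_iff)
  moreover have "(\<lambda>k. ret_tail K i (Suc k)) \<longlonglongrightarrow> 0"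
    using summable_LIMSEQ_zero[OF ret_tail_summable(1)[OF st q]] by (rule LIMSEQ_Suc)
  ultimately have "(\<lambda>k. ret_tail K i (Suc k) - (ret_tail K i (Suc k) - hit_tail K \<pi> i (Suc k))) \<longlonglongrightarrow> 0 - 0"
    by (intro tendsto_diff)
  then have lim: "hit_tail K \<pi> i \<longlonglongrightarrow> 0"
    by (simp add: filterlim_sequentially_Suc)
  have E: "measure (density lborel (exponential_density 1)) {..z} = (if 0 \<le> z then 1 - exp (- z) else 0)"
    using emeasure_erlang_density[of 1 0 z] by (simp add: measure_def erlang_CDF_0)
  show "\<bar>measure (scaled_hit_law K \<pi> i) {..z} - measure (density lborel (exponential_density 1)) {..z}\<bar> \<le> ?b"
  proof (cases "0 \<le> z")
    case True
    let ?m = "Suc (nat \<lfloor>z / ?q\<rfloor>)"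
    have "\<bar>measure (scaled_hit_law K \<pi> i) {..z} - measure (density lborel (exponential_density 1)) {..z}\<bar>
        = \<bar>(exp (- z) - (1 - ?q) ^ ?m) - (hit_tail K \<pi> i ?m - (1 - ?q) ^ ?m)\<bar>"
      using True by (simp add: E measure_scaled_hit_law_atMost[OF q True lim])
    also have "\<dots> \<le> \<bar>exp (- z) - (1 - ?q) ^ ?m\<bar> + \<bar>hit_tail K \<pi> i ?m - (1 - ?q) ^ ?m\<bar>"
      by (rule abs_triangle_ineq4)
    also have "\<dots> \<le> ?b"
      by (intro add_mono exp_minus_geometric_floor hit_tail_geometric st s q True pmf_le_1)
    finally show ?thesis .
  next
    case False
    note hit_time_measurable[measurable]
    have "(\<lambda>\<omega>. ?q * enn2real (ennreal_of_enat (hit_time i \<omega>))) \<in> borel_measurable (path_law K \<pi>)"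
      by measurable
    moreover have "(\<lambda>\<omega>. ?q * enn2real (ennreal_of_enat (hit_time i \<omega>))) -` {..z} = {}"
    proof -
      have "\<not> ?q * enn2real (ennreal_of_enat (hit_time i \<omega>)) \<le> z" for \<omega>
        using False mult_nonneg_nonneg[OF pmf_nonneg enn2real_nonneg, of \<pi> i "ennreal_of_enat (hit_time i \<omega>)"]
        by linarith
      then show ?thesis by auto
    qed
    ultimately have "measure (scaled_hit_law K \<pi> i) {..z} = 0"
      unfolding scaled_hit_law_def by (subst measure_distr) auto
    with b False show ?thesis by (simp add: E)
  qed
qed simp

section \<open>Coupling by a stationary time\<close>

lemma return_time_less_iff: "return_time i \<omega> < a \<longleftrightarrow> (\<exists>t>0. \<omega> t = i \<and> enat t < a)"
  by (auto simp: return_time_def Inf_less_iff)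

lemma suminf_of_bool_eq_card:
  "finite {k. P k} \<Longrightarrow> (\<Sum>k. of_bool (P k) :: ennreal) = of_nat (card {k. P k})"
  by (subst suminf_finite[of "{k. P k}"]) auto

lemma suminf_split_head_ennreal: "suminf f = f 0 + (\<Sum>k. f (Suc k))" for f :: "nat \<Rightarrow> ennreal"
  using suminf_offset[of f 1] by (simp add: add.commute)

text \<open>Here \<open>n\<close> is the value of the stationary time. The left side counts the
  levels separating the return time minus 1 from the wait after \<open>n\<close>. Three cases occur:
  \<open>n = 0\<close>, where the wait is 0; a return before \<open>n\<close>; and no return before
  \<open>n\<close>, where the return time is \<open>n\<close> plus the wait and the count is
  \<open>n - 1\<close> if finite.\<close>

lemma coupling_count:
  fixes x :: "nat \<Rightarrow> 's"
  assumes x0: "n = 0 \<Longrightarrow> x 0 = i"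
  shows "(\<Sum>k. of_bool ((\<forall>t<Suc k. x (Suc t) \<noteq> i) \<noteq> (\<forall>t<Suc k. x (n + t) \<noteq> i)) :: ennreal)
    \<le> (\<Sum>k. of_bool (Suc k < n) + of_bool (n = 0 \<and> (\<forall>t<Suc k. x (Suc t) \<noteq> i))
          + of_bool ((\<exists>t<n. 0 < t \<and> x t = i) \<and> (\<forall>t<Suc k. x (n + t) \<noteq> i)))"
proof (cases "n = 0 \<or> (\<exists>t<n. 0 < t \<and> x t = i)")
  case True
  then show ?thesis
  proof
    assume "n = 0"
    with x0 show ?thesis
      by (intro suminf_le) auto
  next
    assume "\<exists>t<n. 0 < t \<and> x t = i"
    then obtain s where s: "s < n" "0 < s" "x s = i" by auto
    \<comment> \<open>A level exceeded by the return is below \<open>n\<close>; any other mismatch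
      is a level exceeded by the wait after \<open>n\<close>, counted by the last term.\<close>
    have "Suc k < n" if "\<forall>t<Suc k. x (Suc t) \<noteq> i" for k
      using that[rule_format, of "s - 1"] s by (cases "s - 1 < Suc k") auto
    with s show ?thesis
      by (intro suminf_le) auto
  qed
next
  case False
  have "(\<Sum>k. of_bool ((\<forall>t<Suc k. x (Suc t) \<noteq> i) \<noteq> (\<forall>t<Suc k. x (n + t) \<noteq> i)) :: ennreal)
      \<le> (\<Sum>k. of_bool (Suc k < n))"
  proof (cases "\<exists>t. x (n + t) = i")
    case none: False
    have "x (Suc t) \<noteq> i" for t
    proof (cases "Suc t < n")
      case True with False show ?thesis by auto
    next
      case ge: False
      then have "n + (Suc t - n) = Suc t" by simp
      with none show ?thesis by metis
    qed
    with none show ?thesis by simp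
  next
    case True
    define m where "m = (LEAST t. x (n + t) = i)"
    have m: "x (n + m) = i" "\<And>t. t < m \<Longrightarrow> x (n + t) \<noteq> i"
      using LeastI_ex[OF True] not_less_Least[of _ "\<lambda>t. x (n + t) = i"] by (auto simp: m_def)
    have hit: "(\<forall>t<Suc k. x (n + t) \<noteq> i) \<longleftrightarrow> k < m" for k
      using m by (metis less_Suc_eq_le linorder_not_less order.strict_trans1)
    have small: "x t \<noteq> i" if "0 < t" "t < n + m" for t
    proof (cases "t < n")
      case True with False that show ?thesis by auto
    next
      case ge: False
      then show ?thesis using m(2)[of "t - n"] that by auto
    qed
    have ret: "(\<forall>t<Suc k. x (Suc t) \<noteq> i) \<longleftrightarrow> Suc k < n + m" for k
    proof
      assume *: "\<forall>t<Suc k. x (Suc t) \<noteq> i"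
      show "Suc k < n + m"
      proof (rule ccontr)
        assume "\<not> Suc k < n + m"
        moreover have "Suc (n + m - 1) = n + m" using False by auto
        ultimately show False using *[rule_format, of "n + m - 1"] m(1) by auto
      qed
    next
      assume "Suc k < n + m"
      then show "\<forall>t<Suc k. x (Suc t) \<noteq> i"
        by (intro allI impI small) auto
    qed
    \<comment> \<open>Both intervals have \<open>n - 1\<close> elements, so the bound is
      attained.\<close>
    have "{k. (Suc k < n + m) \<noteq> (k < m)} = {m..<n + m - 1}"
      using False by auto
    moreover have "{k. Suc k < n} = {0..<n - 1}"
      by auto
    ultimately show ?thesis
      unfolding hit ret by (simp add: suminf_of_bool_eq_card)
  qed
  also have "\<dots> \<le> (\<Sum>k. of_bool (Suc k < n) + of_bool (n = 0 \<and> (\<forall>t<Suc k. x (Suc t) \<noteq> i))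
          + of_bool ((\<exists>t<n. 0 < t \<and> x t = i) \<and> (\<forall>t<Suc k. x (n + t) \<noteq> i)))"
    by (intro suminf_le) auto
  finally show ?thesis .
qed

lemma (in prob_space) abs_prob_diff_le:
  assumes [measurable]: "Measurable.pred M P" "Measurable.pred M Q"
  shows "\<bar>prob {x \<in> space M. P x} - prob {x \<in> space M. Q x}\<bar> \<le> prob {x \<in> space M. P x \<noteq> Q x}"
proof -
  have "prob {x \<in> space M. P x} \<le> prob ({x \<in> space M. Q x} \<union> {x \<in> space M. P x \<noteq> Q x})"
    by (intro finite_measure_mono) auto
  also have "\<dots> \<le> prob {x \<in> space M. Q x} + prob {x \<in> space M. P x \<noteq> Q x}"
    by (intro measure_Un_le) auto
  finally have 1: "prob {x \<in> space M. P x} \<le> prob {x \<in> space M. Q x} + prob {x \<in> space M. P x \<noteq> Q x}" .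
  have "prob {x \<in> space M. Q x} \<le> prob ({x \<in> space M. P x} \<union> {x \<in> space M. P x \<noteq> Q x})"
    by (intro finite_measure_mono) auto
  also have "\<dots> \<le> prob {x \<in> space M. P x} + prob {x \<in> space M. P x \<noteq> Q x}"
    by (intro measure_Un_le) auto
  finally show ?thesis using 1 by simp
qed

lemma nn_integral_of_bool:
  assumes "Measurable.pred M P"
  shows "(\<integral>\<^sup>+ x. of_bool (P x) \<partial>M) = emeasure M {x \<in> space M. P x}"
proof -
  have "(\<integral>\<^sup>+ x. of_bool (P x) \<partial>M) = (\<integral>\<^sup>+ x. indicator {x \<in> space M. P x} x \<partial>M)"
    by (intro nn_integral_cong) (auto split: split_indicator)
  then show ?thesis
    using assms by (simp add: pred_def)
qed

context markov_chain
begin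

text \<open>On \<open>M\<close> the events \<open>Ret\<close> and \<open>Hit\<close> realise both
  tails jointly, as the chain restarts from \<open>\<pi>\<close> at \<open>T\<close>. Each gap is
  then at most a mismatch probability, and \<open>coupling_count\<close> is integrated to bound
  their sum.\<close>

lemma tail_gap_le_stationary_time:
  assumes st: "stationary K \<pi>" and q: "0 < pmf \<pi> i"
    and X0: "AE \<omega> in M. X 0 \<omega> = i" and T: "stationary_time M F X \<pi> T"
  shows "(\<Sum>k. ennreal (tail_gap K \<pi> i k))
    \<le> (\<integral>\<^sup>+ \<omega>. ennreal_of_enat (T \<omega>) \<partial>M)
      + ennreal (prob {\<omega> \<in> space M. return_time i (\<lambda>t. X t \<omega>) < T \<omega>}) * (SUP j. mean_return_time K j i)"
proof -
  have stop: "stopping_time F T" and fin: "AE \<omega> in M. T \<omega> < \<infinity>"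
    and law: "distr M (count_space UNIV) (\<lambda>\<omega>. X (the_enat (T \<omega>)) \<omega>) = measure_pmf \<pi>"
    using T by (auto simp: stationary_time_def)
  note stopping_time_measurable[OF stop, measurable] state_at_measurable[OF stop, measurable]
  have XT [measurable]: "(\<lambda>\<omega>. X (the_enat (T \<omega>)) \<omega>) \<in> M \<rightarrow>\<^sub>M count_space UNIV"
    using state_at_measurable[OF stop, of 0] by simp
  define Ret where "Ret k \<omega> \<longleftrightarrow> (\<forall>t<k. X (Suc t) \<omega> \<noteq> i)" for k \<omega>
  define Hit where "Hit k \<omega> \<longleftrightarrow> (\<forall>t<k. X (the_enat (T \<omega>) + t) \<omega> \<noteq> i)" for k \<omega>
  define Early where "Early \<omega> \<longleftrightarrow> (\<exists>t>0. X t \<omega> = i \<and> enat t < T \<omega>)" for \<omega>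
  have [measurable]: "Measurable.pred M (Ret k)" "Measurable.pred M (Hit k)" "Measurable.pred M Early" for k
    unfolding Ret_def[abs_def] Hit_def[abs_def] Early_def[abs_def] by measurable
  define p where "p = emeasure M {\<omega> \<in> space M. T \<omega> = 0}"

  \<comment> \<open>As \<open>X 0\<close> is almost surely \<open>i\<close>, events of
    \<open>F 0\<close> are independent of \<open>Ret\<close>. This serves for the event
    \<open>T = 0\<close>, which randomization may make nontrivial.\<close>
  have markov_Ret: "emeasure M {\<omega> \<in> space M. \<omega> \<in> B \<and> Ret k \<omega>} = emeasure M B * avoid_after K i k i"
    if B: "B \<in> sets (F 0)" for B k
  proof -
    have [measurable]: "B \<in> sets M" by (rule sets_F[OF B])
    have "emeasure M {\<omega> \<in> space M. \<omega> \<in> B \<and> Ret k \<omega>} = (\<integral>\<^sup>+ \<omega>. of_bool (\<omega> \<in> B \<and> Ret k \<omega>) \<partial>M)"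
      by (rule nn_integral_of_bool[symmetric]) measurable
    also have "\<dots> = (\<integral>\<^sup>+ \<omega>. indicator B \<omega> * indicator {\<omega>. \<forall>t<k. X (Suc (0 + t)) \<omega> \<noteq> i} \<omega> \<partial>M)"
      by (intro nn_integral_cong) (auto simp: Ret_def split: split_indicator)
    also have "\<dots> = (\<integral>\<^sup>+ \<omega>. indicator B \<omega> * avoid_after K i k (X 0 \<omega>) \<partial>M)"
      using B by (intro nn_integral_avoid_after) (simp add: zero_enat_def)
    also have "\<dots> = (\<integral>\<^sup>+ \<omega>. indicator B \<omega> * avoid_after K i k i \<partial>M)"
      using X0 by (intro nn_integral_cong_AE) auto
    finally show ?thesis
      by (simp add: nn_integral_multc)
  qed
  have emeasure_Ret: "emeasure M {\<omega> \<in> space M. Ret k \<omega>} = avoid_after K i k i" for k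
    using markov_Ret[of "space M" k] sets.top[of "F 0"] by (simp add: space_F emeasure_space_1)
  have emeasure_Hit: "emeasure M {\<omega> \<in> space M. Hit k \<omega>} = (\<integral>\<^sup>+ x. avoid K i k x \<partial>measure_pmf \<pi>)" for k
  proof -
    have "emeasure M {\<omega> \<in> space M. Hit k \<omega>} = (\<integral>\<^sup>+ \<omega>. of_bool (Hit k \<omega>) \<partial>M)"
      by (rule nn_integral_of_bool[symmetric]) measurable
    also have "\<dots> = (\<integral>\<^sup>+ \<omega>. indicator (space M) \<omega>
        * indicator {\<omega>. \<forall>t<k. X (the_enat (T \<omega>) + t) \<omega> \<noteq> i} \<omega> \<partial>M)"
      by (intro nn_integral_cong) (auto simp: Hit_def split: split_indicator)
    also have "\<dots> = (\<integral>\<^sup>+ \<omega>. indicator (space M) \<omega> * avoid K i k (X (the_enat (T \<omega>)) \<omega>) \<partial>M)"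
      by (rule strong_markov_avoid[OF stop fin]) (auto intro: stopping_time_eq_sets[OF stop])
    also have "\<dots> = (\<integral>\<^sup>+ \<omega>. avoid K i k (X (the_enat (T \<omega>)) \<omega>) \<partial>M)"
      by (intro nn_integral_cong) auto
    also have "\<dots> = (\<integral>\<^sup>+ x. avoid K i k x \<partial>measure_pmf \<pi>)"
      unfolding law[symmetric] by (rule nn_integral_distr[symmetric]) auto
    finally show ?thesis .
  qed

  \<comment> \<open>At \<open>T = 0\<close> the chain sits at \<open>i\<close>, so \<open>p\<close>
    is at most \<open>pmf \<pi> i\<close>. Hence \<open>p\<close> times the sum of all return tails
    is at most 1, that is, \<open>p\<close> plus the probability of \<open>T > 0\<close>; the
    summand \<open>k = 0\<close> equals \<open>p\<close> and cancels.\<close>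
  have zero: "(\<Sum>k. emeasure M {\<omega> \<in> space M. T \<omega> = 0 \<and> Ret (Suc k) \<omega>})
      \<le> emeasure M {\<omega> \<in> space M. 0 < T \<omega>}"
  proof -
    have "p \<le> emeasure M {\<omega> \<in> space M. X (the_enat (T \<omega>)) \<omega> = i}"
      unfolding p_def
    proof (rule emeasure_mono_AE)
      show "AE \<omega> in M. \<omega> \<in> {\<omega> \<in> space M. T \<omega> = 0} \<longrightarrow> \<omega> \<in> {\<omega> \<in> space M. X (the_enat (T \<omega>)) \<omega> = i}"
        using X0 by eventually_elim (auto simp: zero_enat_def)
    qed measurable
    also have "\<dots> = emeasure (distr M (count_space UNIV) (\<lambda>\<omega>. X (the_enat (T \<omega>)) \<omega>)) {i}"
      by (subst emeasure_distr) (auto intro!: arg_cong[where f = "emeasure M"])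
    also have "\<dots> = ennreal (pmf \<pi> i)"
      by (simp add: law emeasure_pmf_single)
    finally have p_le: "p \<le> ennreal (pmf \<pi> i)" .
    have "p + (\<Sum>k. p * avoid_after K i (Suc k) i) = (\<Sum>k. p * avoid_after K i k i)"
      by (subst suminf_split_head_ennreal[of "\<lambda>k. p * avoid_after K i k i"]) (simp add: avoid_after_0)
    also have "\<dots> \<le> ennreal (pmf \<pi> i) * (\<Sum>k. ennreal (ret_tail K i k))"
      by (simp add: ennreal_ret_tail p_le mult_right_mono)
    also have "\<dots> = ennreal (pmf \<pi> i * (\<Sum>k. ret_tail K i k))"
      using ret_tail_summable(1)[OF st q] by (simp add: suminf_ennreal2 ret_tail_nonneg ennreal_mult')
    also have "\<dots> \<le> 1"
      using ret_tail_summable(2)[OF st q] by simp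
    also have "1 = p + emeasure M {\<omega> \<in> space M. 0 < T \<omega>}"
    proof -
      have "p + emeasure M {\<omega> \<in> space M. 0 < T \<omega>}
          = emeasure M ({\<omega> \<in> space M. T \<omega> = 0} \<union> {\<omega> \<in> space M. 0 < T \<omega>})"
        unfolding p_def by (rule plus_emeasure) auto
      also have "{\<omega> \<in> space M. T \<omega> = 0} \<union> {\<omega> \<in> space M. 0 < T \<omega>} = space M"
        by (auto simp: zero_less_iff_neq_zero)
      finally show ?thesis by (simp add: emeasure_space_1)
    qed
    finally have "(\<Sum>k. p * avoid_after K i (Suc k) i) \<le> emeasure M {\<omega> \<in> space M. 0 < T \<omega>}"
      by (simp add: ennreal_add_left_cancel_le p_def)
    moreover have "emeasure M {\<omega> \<in> space M. T \<omega> = 0 \<and> Ret (Suc k) \<omega>} = p * avoid_after K i (Suc k) i" for k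
      using markov_Ret[of "{\<omega> \<in> space M. T \<omega> = 0}" "Suc k"] stopping_time_eq_sets[OF stop, of 0]
      by (simp add: p_def zero_enat_def conj_assoc)
    ultimately show ?thesis by simp
  qed

  \<comment> \<open>\<open>Early\<close> is decided by the path before \<open>T\<close>, so the
    strong Markov property applies on it; the mean wait from the state at \<open>T\<close> is at
    most the supremum.\<close>
  have early: "(\<Sum>k. emeasure M {\<omega> \<in> space M. Early \<omega> \<and> Hit (Suc k) \<omega>})
      \<le> emeasure M {\<omega> \<in> space M. Early \<omega>} * (SUP j. mean_return_time K j i)"
  proof -
    let ?B = "{\<omega> \<in> space M. Early \<omega>}"
    have B: "{\<omega> \<in> ?B. T \<omega> = enat n} \<in> sets (F (enat n))" for n
    proof -
      note adapted [measurable]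
      have "{\<omega> \<in> space (F (enat t)). X t \<omega> = i} \<in> sets (F (enat t))" for t
        by measurable
      then have "{\<omega> \<in> space M. X t \<omega> = i} \<in> sets (F (enat n))" if "t < n" for t
        using that sets_F_mono[of "enat t" "enat n"] by (auto simp: space_F)
      then have "{\<omega> \<in> space M. T \<omega> = enat n} \<inter> (\<Union>t\<in>{0<..<n}. {\<omega> \<in> space M. X t \<omega> = i}) \<in> sets (F (enat n))"
        by (intro sets.Int sets.finite_UN stopping_time_eq_sets[OF stop]) auto
      also have "{\<omega> \<in> space M. T \<omega> = enat n} \<inter> (\<Union>t\<in>{0<..<n}. {\<omega> \<in> space M. X t \<omega> = i})
          = {\<omega> \<in> ?B. T \<omega> = enat n}"
        by (auto simp: Early_def)
      finally show ?thesis .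
    qed
    have "emeasure M {\<omega> \<in> space M. Early \<omega> \<and> Hit k \<omega>}
        = (\<integral>\<^sup>+ \<omega>. indicator ?B \<omega> * avoid K i k (X (the_enat (T \<omega>)) \<omega>) \<partial>M)" for k
    proof -
      have "emeasure M {\<omega> \<in> space M. Early \<omega> \<and> Hit k \<omega>} = (\<integral>\<^sup>+ \<omega>. of_bool (Early \<omega> \<and> Hit k \<omega>) \<partial>M)"
        by (rule nn_integral_of_bool[symmetric]) measurable
      also have "\<dots> = (\<integral>\<^sup>+ \<omega>. indicator ?B \<omega>
          * indicator {\<omega>. \<forall>t<k. X (the_enat (T \<omega>) + t) \<omega> \<noteq> i} \<omega> \<partial>M)"
        by (intro nn_integral_cong) (auto simp: Hit_def split: split_indicator)
      also have "\<dots> = (\<integral>\<^sup>+ \<omega>. indicator ?B \<omega> * avoid K i k (X (the_enat (T \<omega>)) \<omega>) \<partial>M)"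
        by (rule strong_markov_avoid[OF stop fin B]) measurable
      finally show ?thesis .
    qed
    then have "(\<Sum>k. emeasure M {\<omega> \<in> space M. Early \<omega> \<and> Hit (Suc k) \<omega>})
        = (\<Sum>k. \<integral>\<^sup>+ \<omega>. indicator ?B \<omega> * avoid K i (Suc k) (X (the_enat (T \<omega>)) \<omega>) \<partial>M)"
      by simp
    also have "\<dots> = (\<integral>\<^sup>+ \<omega>. (\<Sum>k. indicator ?B \<omega> * avoid K i (Suc k) (X (the_enat (T \<omega>)) \<omega>)) \<partial>M)"
      by (intro nn_integral_suminf[symmetric] borel_measurable_times_ennreal measurable_compose[OF XT]
          borel_measurable_indicator) auto
    also have "\<dots> \<le> (\<integral>\<^sup>+ \<omega>. indicator ?B \<omega> * (SUP j. mean_return_time K j i) \<partial>M)"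
    proof (intro nn_integral_mono)
      fix \<omega>
      let ?x = "X (the_enat (T \<omega>)) \<omega>"
      have "(\<Sum>k. avoid K i (Suc k) ?x) \<le> (SUP j. mean_return_time K j i)"
        using sum_avoid_le_mean_return_time by (rule order_trans) (rule SUP_upper, simp)
      then show "(\<Sum>k. indicator ?B \<omega> * avoid K i (Suc k) ?x) \<le> indicator ?B \<omega> * (SUP j. mean_return_time K j i)"
        by (simp only: ennreal_suminf_cmult) (rule mult_left_mono, simp_all)
    qed
    also have "\<dots> = emeasure M ?B * (SUP j. mean_return_time K j i)"
      by (simp add: nn_integral_multc)
    finally show ?thesis .
  qed

  have "(\<Sum>k. ennreal (tail_gap K \<pi> i k))
      \<le> (\<Sum>k. emeasure M {\<omega> \<in> space M. Ret (Suc k) \<omega> \<noteq> Hit (Suc k) \<omega>})"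
  proof (intro suminf_le allI)
    fix k
    have "tail_gap K \<pi> i k = \<bar>prob {\<omega> \<in> space M. Ret (Suc k) \<omega>} - prob {\<omega> \<in> space M. Hit (Suc k) \<omega>}\<bar>"
      by (simp only: tail_gap_def ret_tail_def hit_tail_def measure_def emeasure_Ret emeasure_Hit)
    also have "\<dots> \<le> prob {\<omega> \<in> space M. Ret (Suc k) \<omega> \<noteq> Hit (Suc k) \<omega>}"
      by (rule abs_prob_diff_le) measurable
    finally show "ennreal (tail_gap K \<pi> i k) \<le> emeasure M {\<omega> \<in> space M. Ret (Suc k) \<omega> \<noteq> Hit (Suc k) \<omega>}"
      by (simp add: emeasure_eq_measure ennreal_leI)
  qed auto
  also have "\<dots> = (\<Sum>k. \<integral>\<^sup>+ \<omega>. of_bool (Ret (Suc k) \<omega> \<noteq> Hit (Suc k) \<omega>) \<partial>M)"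
    by (subst nn_integral_of_bool) measurable
  also have "\<dots> = (\<integral>\<^sup>+ \<omega>. (\<Sum>k. of_bool (Ret (Suc k) \<omega> \<noteq> Hit (Suc k) \<omega>)) \<partial>M)"
    by (rule nn_integral_suminf[symmetric]) measurable
  also have "\<dots> \<le> (\<integral>\<^sup>+ \<omega>. (\<Sum>k. of_bool (enat (Suc k) < T \<omega>) + of_bool (T \<omega> = 0 \<and> Ret (Suc k) \<omega>)
      + of_bool (Early \<omega> \<and> Hit (Suc k) \<omega>)) \<partial>M)"
  proof (rule nn_integral_mono_AE)
    show "AE \<omega> in M. (\<Sum>k. of_bool (Ret (Suc k) \<omega> \<noteq> Hit (Suc k) \<omega>))
        \<le> (\<Sum>k. of_bool (enat (Suc k) < T \<omega>) + of_bool (T \<omega> = 0 \<and> Ret (Suc k) \<omega>)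
          + of_bool (Early \<omega> \<and> Hit (Suc k) \<omega>) :: ennreal)"
      using fin X0
    proof eventually_elim
      case (elim \<omega>)
      then obtain n where n: "T \<omega> = enat n" by auto
      have "Early \<omega> \<longleftrightarrow> (\<exists>t<n. 0 < t \<and> X t \<omega> = i)"
        by (auto simp: Early_def n)
      then show ?case
        using coupling_count[of n "\<lambda>t. X t \<omega>" i] elim(2) by (simp add: Ret_def Hit_def n zero_enat_def)
    qed
  qed
  also have "\<dots> = (\<Sum>k. \<integral>\<^sup>+ \<omega>. of_bool (enat (Suc k) < T \<omega>) + of_bool (T \<omega> = 0 \<and> Ret (Suc k) \<omega>)
      + of_bool (Early \<omega> \<and> Hit (Suc k) \<omega>) \<partial>M)"
    by (rule nn_integral_suminf) measurable
  also have "\<dots> = (\<Sum>k. emeasure M {\<omega> \<in> space M. enat (Suc k) < T \<omega>}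
      + emeasure M {\<omega> \<in> space M. T \<omega> = 0 \<and> Ret (Suc k) \<omega>}
      + emeasure M {\<omega> \<in> space M. Early \<omega> \<and> Hit (Suc k) \<omega>})"
    by (simp add: nn_integral_add nn_integral_of_bool)
  also have "\<dots> = (\<Sum>k. emeasure M {\<omega> \<in> space M. enat (Suc k) < T \<omega>})
      + (\<Sum>k. emeasure M {\<omega> \<in> space M. T \<omega> = 0 \<and> Ret (Suc k) \<omega>})
      + (\<Sum>k. emeasure M {\<omega> \<in> space M. Early \<omega> \<and> Hit (Suc k) \<omega>})"
    by (simp add: suminf_add[symmetric])
  also have "\<dots> \<le> (\<Sum>k. emeasure M {\<omega> \<in> space M. enat (Suc k) < T \<omega>})
      + emeasure M {\<omega> \<in> space M. 0 < T \<omega>}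
      + emeasure M {\<omega> \<in> space M. Early \<omega>} * (SUP j. mean_return_time K j i)"
    by (intro add_mono order_refl zero early)
  \<comment> \<open>The bound for \<open>T = 0\<close> is exactly the missing first term of the tail
    sum for the mean of \<open>T\<close>.\<close>
  also have "(\<Sum>k. emeasure M {\<omega> \<in> space M. enat (Suc k) < T \<omega>}) + emeasure M {\<omega> \<in> space M. 0 < T \<omega>}
      = (\<integral>\<^sup>+ \<omega>. ennreal_of_enat (T \<omega>) \<partial>M)"
    by (subst nn_integral_enat_function, measurable,
        subst suminf_split_head_ennreal[of "\<lambda>k. emeasure M {\<omega> \<in> space M. enat k < T \<omega>}"])
      (simp add: zero_enat_def add.commute)
  also have "emeasure M {\<omega> \<in> space M. Early \<omega>}
      = ennreal (prob {\<omega> \<in> space M. return_time i (\<lambda>t. X t \<omega>) < T \<omega>})"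
    by (simp add: Early_def return_time_less_iff emeasure_eq_measure)
  finally show ?thesis .
qed

end

theorem corollary3p3:
  fixes K :: "'s::countable \<Rightarrow> 's pmf" and \<pi> :: "'s pmf" and i :: 's
    and M :: "'a measure" and F :: "enat \<Rightarrow> 'a measure"
    and X :: "nat \<Rightarrow> 'a \<Rightarrow> 's" and T :: "'a \<Rightarrow> enat" and \<rho> :: real
  assumes "ergodic K" and "stationary K \<pi>"
    and "markov_chain M F X K" and "AE \<omega> in M. X 0 \<omega> = i"
    and "stationary_time M F X \<pi> T"
    and "\<rho> = measure M {\<omega> \<in> space M. return_time i (\<lambda>t. X t \<omega>) < T \<omega>}"
  shows "ennreal (kolmogorov_dist (scaled_hit_law K \<pi> i) (density lborel (exponential_density 1)))
    \<le> 2 * ennreal (pmf \<pi> i)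
      + min (ennreal (pmf \<pi> i)
               * ((\<integral>\<^sup>+ \<omega>. ennreal_of_enat (T \<omega>) \<partial>M)
                  + ennreal \<rho> * (SUP j. mean_return_time K j i)))
            (\<Sum>n. ennreal \<bar>pmf (nstep K (Suc n) i) i - pmf \<pi> i\<bar>)"
proof -
  interpret markov_chain M F X K by fact
  let ?S = "\<Sum>k. ennreal (tail_gap K \<pi> i k)"
  have q: "0 < pmf \<pi> i"
    using assms(1,2) by (auto simp: ergodic_def intro: stationary_irreducible_pos)
  have "ennreal (kolmogorov_dist (scaled_hit_law K \<pi> i) (density lborel (exponential_density 1)))
      \<le> 2 * ennreal (pmf \<pi> i) + ennreal (pmf \<pi> i) * ?S"
  \<comment> \<open>If the sum is infinite, positivity of \<open>pmf \<pi> i\<close> makes the right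
    side infinite.\<close>
  proof (cases "?S = top")
    case True
    then show ?thesis
      using q by (simp add: ennreal_mult_top)
  next
    case False
    then have s: "summable (tail_gap K \<pi> i)"
      by (intro summable_suminf_not_top tail_gap_nonneg)
    have "ennreal (2 * pmf \<pi> i + pmf \<pi> i * (\<Sum>k. tail_gap K \<pi> i k)) = 2 * ennreal (pmf \<pi> i) + ennreal (pmf \<pi> i) * ?S"
      using suminf_nonneg[OF s tail_gap_nonneg] s
      by (simp add: suminf_ennreal2 tail_gap_nonneg ennreal_mult)
    then show ?thesis
      using ennreal_leI[OF kolmogorov_dist_hit_le[OF assms(2) q s]] by simp
  qed
  also have "\<dots> \<le> 2 * ennreal (pmf \<pi> i)
      + min (ennreal (pmf \<pi> i)
               * ((\<integral>\<^sup>+ \<omega>. ennreal_of_enat (T \<omega>) \<partial>M)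
                  + ennreal \<rho> * (SUP j. mean_return_time K j i)))
            (\<Sum>n. ennreal \<bar>pmf (nstep K (Suc n) i) i - pmf \<pi> i\<bar>)"
    unfolding assms(6)
    by (intro add_left_mono min.boundedI mult_left_mono zero_le
        tail_gap_le_stationary_time[OF assms(2) q assms(4,5)] tail_gap_le_renewal_sum[OF assms(2) q])
  finally show ?thesis .
qed

end
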